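(* Let $n,d\ge1$. The set of typical sos lengths for $\Sigma_{n,2d}$ is $T(n,2d)=\{t,\,t+1,\,\dots,\,p\}$, where $t=t(n,2d)$ and $p=p(n,2d)$.
   Context: Let $\mathtt{x}=(x_1,\dots,x_n)$ and let $\mathbb{R}[\mathtt{x}]_e$, $\mathbb{C}[\mathtt{x}]_e$ denote the spaces of forms of degree $e$ with real, respectively complex, coefficients. Let $\Sigma_{n,2d}\subseteq\mathbb{R}[\mathtt{x}]_{2d}$ be the set of forms of degree $2d$ that are finite sums of squares of forms in $\mathbb{R}[\mathtt{x}]_d$. For $f\in\Sigma_{n,2d}$ the sos length $\ell(f)$ is the smallest $r\ge0$ such that $f=p_1^2+\cdots+p_r^2$ for some $p_1,\dots,p_r\in\mathbb{R}[\mathtt{x}]_d$, and $p(n,2d)=\sup\{\ell(f)\colon f\in\Sigma_{n,2d}\}$. $t(n,2d)$ is the minimal number $t\ge1$ for which the set $\{p_1^2+\cdots+p_t^2\colon p_1,\dots,p_t\in\mathbb{C}[\mathtt{x}]_d\}$ is Zariski dense in $\mathbb{C}[\mathtt{x}]_{2d}$. For $r\ge0$ put $\Sigma_{n,2d}(r)=\{f\in\Sigma_{n,2d}\colon\ell(f)\le r\}$. The set of typical sos lengths is $$T(n,2d)=\bigl\{r\ge1\colon\Sigma_{n,2d}(r)\setminus\Sigma_{n,2d}(r-1)\text{ has nonempty interior in }\mathbb{R}[\mathtt{x}]_{2d}\bigr\}.$$ *)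

theory Defs
  imports "HOL-Analysis.Analysis" "HOL-Library.Poly_Mapping" "HOL-Library.Extended_Nat"
begin

text \<open>
  A polynomial is a finitely supported map from exponent vectors to coefficients; multiplication
  is the convolution product of \<^theory>\<open>HOL-Library.Poly_Mapping\<close>. The variables are indexed by
  \<^typ>\<open>nat\<close>, and \<open>n\<close> variables means indices in \<open>{..<n}\<close>.
\<close>

type_synonym 'a mpoly = "(nat \<Rightarrow>\<^sub>0 nat) \<Rightarrow>\<^sub>0 'a"

text \<open>As usual, the zero polynomial counts as a form of every degree.\<close>

definition forms :: "nat \<Rightarrow> nat \<Rightarrow> 'a::zero mpoly set" where
  "forms n e = {f. \<forall>m \<in> Poly_Mapping.keys f.
     Poly_Mapping.keys m \<subseteq> {..<n} \<and> (\<Sum>i<n. Poly_Mapping.lookup m i) = e}"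

definition sums_of_squares :: "nat \<Rightarrow> nat \<Rightarrow> nat \<Rightarrow> 'a::comm_ring_1 mpoly set" where
  "sums_of_squares n d r = {\<Sum>i<r. p i ^ 2 |p. \<forall>i<r. p i \<in> forms n d}"

text \<open>
  In the following, the arguments \<open>n d\<close> correspond to the subscript (or argument) \<open>n, 2d\<close>
  of the mathematical notation.
\<close>

definition sos_cone :: "nat \<Rightarrow> nat \<Rightarrow> real mpoly set" where
  "sos_cone n d = (\<Union>r. sums_of_squares n d r)"

definition sos_length :: "nat \<Rightarrow> nat \<Rightarrow> real mpoly \<Rightarrow> nat" where
  "sos_length n d f = (LEAST r. f \<in> sums_of_squares n d r)"

definition pythagoras_number :: "nat \<Rightarrow> nat \<Rightarrow> enat" where
  "pythagoras_number n d = (SUP f \<in> sos_cone n d. enat (sos_length n d f))"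

definition sos_cone_upto :: "nat \<Rightarrow> nat \<Rightarrow> nat \<Rightarrow> real mpoly set" where
  "sos_cone_upto n d r = {f \<in> sos_cone n d. sos_length n d f \<le> r}"

text \<open>
  Polynomial functions in the coefficients. Restricted to \<open>forms n e\<close> (where all but
  finitely many coefficients vanish identically), these are exactly the polynomial functions on
  that finite-dimensional vector space.
\<close>

inductive_set coeff_polynomials :: "('a::field mpoly \<Rightarrow> 'a) set" where
  const: "(\<lambda>f. c) \<in> coeff_polynomials"
| coeff: "(\<lambda>f. Poly_Mapping.lookup f m) \<in> coeff_polynomials"
| add: "\<phi> \<in> coeff_polynomials \<Longrightarrow> \<psi> \<in> coeff_polynomials \<Longrightarrow> (\<lambda>f. \<phi> f + \<psi> f) \<in> coeff_polynomials"
| mult: "\<phi> \<in> coeff_polynomials \<Longrightarrow> \<psi> \<in> coeff_polynomials \<Longrightarrow> (\<lambda>f. \<phi> f * \<psi> f) \<in> coeff_polynomials"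

definition zariski_closed_in_forms :: "nat \<Rightarrow> nat \<Rightarrow> 'a::field mpoly set \<Rightarrow> bool" where
  "zariski_closed_in_forms n e Z \<longleftrightarrow>
     (\<exists>\<Phi> \<subseteq> coeff_polynomials. Z = {f \<in> forms n e. \<forall>\<phi>\<in>\<Phi>. \<phi> f = 0})"

definition zariski_dense_in_forms :: "nat \<Rightarrow> nat \<Rightarrow> 'a::field mpoly set \<Rightarrow> bool" where
  "zariski_dense_in_forms n e S \<longleftrightarrow>
     \<Inter>{Z. zariski_closed_in_forms n e Z \<and> S \<subseteq> Z} = forms n e"

definition generic_sos_length :: "nat \<Rightarrow> nat \<Rightarrow> nat" where
  "generic_sos_length n d =
     (LEAST t. 1 \<le> t \<and>
        zariski_dense_in_forms n (2 * d) (sums_of_squares n d t :: complex mpoly set))"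

text \<open>
  The Euclidean topology on a space of real forms: the coefficient map is injective, and the
  product topology on its range is the Euclidean one, since only finitely many coefficients
  of a form of given degree in \<open>n\<close> variables can be nonzero.
\<close>

definition forms_topology :: "nat \<Rightarrow> nat \<Rightarrow> real mpoly topology" where
  "forms_topology n e = pullback_topology (forms n e) Poly_Mapping.lookup euclidean"

definition typical_sos_lengths :: "nat \<Rightarrow> nat \<Rightarrow> nat set" where
  "typical_sos_lengths n d =
     {r. 1 \<le> r \<and>
         forms_topology n (2 * d) interior_of (sos_cone_upto n d r - sos_cone_upto n d (r - 1)) \<noteq> {}}"

end

theory Submission imports Defs begin

text \<open>
  Write \<open>\<Sigma>(r)\<close> for the real sums of \<open>r\<close> squares. Each \<open>\<Sigma>(r)\<close> is closed, because the sum-of-squares map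
  is homogeneous and has no real zero besides \<open>0\<close>. If the complex sums of \<open>r\<close> squares are Zariski
  dense, the coefficients of the generic sum of \<open>r\<close> squares are algebraically independent, so by the
  Jacobian criterion the sum-of-squares map is a submersion off a real hypersurface, and
  \<open>\<Sigma>(r)\<close> lies in the closure of its interior; if they are not dense, \<open>\<Sigma>(r)\<close> lies in a
  hypersurface and has empty interior. Hence for \<open>t \<le> r \<le> p\<close> the difference \<open>\<Sigma>(r) - \<Sigma>(r-1)\<close>, which is nonempty
  since equality would persist for all larger \<open>r\<close>, has interior points. Caratheodory's argument
  shows that \<open>p\<close> is finite.
\<close>

text \<open>Density is a complex condition, interior a real one; algebraic independence of the
  coefficients of a sum of squares mediates between them. It descends to the reals because the
  sum-of-squares map has coefficients 0 and 1 and a complex polynomial is determined by its values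
  at real points. The latter also shows that a real ball of sums of squares excludes every complex
  relation. A form f in \<Sigma>(r) - \<Sigma>(r-1) need not be interior to \<Sigma>(r), so
  closedness of \<Sigma>(r-1) enters twice: it leaves room to move f to an interior point g of
  \<Sigma>(r) outside \<Sigma>(r-1), and then a ball around g that misses \<Sigma>(r-1). That t
  \<le> p is a separate point: \<Sigma>(t) has interior and is contained in \<Sigma>(p). Polynomials
  appear as functions with a degree bound because the arguments about them count degrees: finitely
  many zeros on a line, a grid count, a relation of least degree.\<close>

lemma underdetermined_system:
  fixes a :: "'e \<Rightarrow> 'u \<Rightarrow> 'b::field"
  assumes "finite E" "finite U" "card E < card U"
  shows "\<exists>c. (\<exists>u\<in>U. c u \<noteq> 0) \<and> (\<forall>e\<in>E. (\<Sum>u\<in>U. a e u * c u) = 0)"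
  using assms
proof (induction E arbitrary: U a rule: finite_induct)
  case empty
  then obtain u where "u \<in> U" by fastforce
  then show ?case by (intro exI[of _ "\<lambda>_. 1"]) auto
next
  case (insert e E)
  show ?case
  proof (cases "\<forall>u\<in>U. a e u = 0")
    case True
    obtain c where "\<exists>u\<in>U. c u \<noteq> 0" "\<forall>e\<in>E. (\<Sum>u\<in>U. a e u * c u) = 0"
      using insert.IH[of U a] insert.prems insert.hyps by auto
    then show ?thesis using True by (intro exI[of _ c]) auto
  next
    case False
    then obtain v where v: "v \<in> U" "a e v \<noteq> 0" by blast
    have "card E < card (U - {v})"
      using insert.prems insert.hyps v by simp
    \<comment> \<open>Gaussian elimination: with pivot \<open>a e v\<close>, equation
      \<open>e\<close> removes the unknown \<open>v\<close> from all other equations.\<close>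
    then obtain c where c: "\<exists>u\<in>U - {v}. c u \<noteq> 0"
        "\<forall>e'\<in>E. (\<Sum>u\<in>U - {v}. (a e' u - a e' v * a e u / a e v) * c u) = 0"
      using insert.IH[of "U - {v}" "\<lambda>e' u. a e' u - a e' v * a e u / a e v"] insert.prems
      by auto
    \<comment> \<open>The value at \<open>v\<close> is the one forced by equation
      \<open>e\<close>.\<close>
    define c' where "c' = c(v := - (\<Sum>u\<in>U - {v}. a e u * c u) / a e v)"
    have split: "(\<Sum>u\<in>U. a e' u * c' u) = a e' v * c' v + (\<Sum>u\<in>U - {v}. a e' u * c u)" for e'
    proof -
      have "(\<Sum>u\<in>U. a e' u * c' u) = a e' v * c' v + (\<Sum>u\<in>U - {v}. a e' u * c' u)"
        using v insert.prems by (simp add: sum.remove)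
      also have "(\<Sum>u\<in>U - {v}. a e' u * c' u) = (\<Sum>u\<in>U - {v}. a e' u * c u)"
        by (rule sum.cong) (auto simp: c'_def)
      finally show ?thesis .
    qed
    have "(\<Sum>u\<in>U. a e' u * c' u) = 0" if "e' \<in> insert e E" for e'
    proof (cases "e' = e")
      case True
      have "c' v = - (\<Sum>u\<in>U - {v}. a e u * c u) / a e v" by (simp add: c'_def)
      then show ?thesis unfolding split using True v by simp
    next
      case False
      with that have "(\<Sum>u\<in>U - {v}. (a e' u - a e' v * a e u / a e v) * c u) = 0"
        using c by auto
      moreover have "(\<Sum>u\<in>U - {v}. (a e' u - a e' v * a e u / a e v) * c u) =
          (\<Sum>u\<in>U - {v}. a e' u * c u) - a e' v / a e v * (\<Sum>u\<in>U - {v}. a e u * c u)"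
        by (simp add: sum_distrib_left sum_subtractf left_diff_distrib mult.assoc)
      moreover have "c' v = - (\<Sum>u\<in>U - {v}. a e u * c u) / a e v" by (simp add: c'_def)
      ultimately show ?thesis unfolding split using v by (simp add: algebra_simps)
    qed
    moreover have "\<exists>u\<in>U. c' u \<noteq> 0" using c(1) by (auto simp: c'_def)
    ultimately show ?thesis by blast
  qed
qed

section \<open>Polynomial functions\<close>

text \<open>The index is an upper bound for the total degree, not the degree: \<open>const\<close>
  and \<open>coord\<close> carry slack so that \<open>add\<close> can ask for one common
  bound.\<close>

inductive polyfun :: "'a set \<Rightarrow> nat \<Rightarrow> (('a \<Rightarrow> 'b::field) \<Rightarrow> 'b) \<Rightarrow> bool" for I where
  const: "polyfun I k (\<lambda>x. c)"
| coord: "i \<in> I \<Longrightarrow> polyfun I (Suc k) (\<lambda>x. x i)"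
| add: "polyfun I k p \<Longrightarrow> polyfun I k q \<Longrightarrow> polyfun I k (\<lambda>x. p x + q x)"
| mult: "polyfun I k p \<Longrightarrow> polyfun I l q \<Longrightarrow> polyfun I (k + l) (\<lambda>x. p x * q x)"

text \<open>Multiplication by the constant 1, which admits every bound, raises the bound.\<close>

lemma polyfun_mono:
  assumes "polyfun I k p" "k \<le> l"
  shows "polyfun I l p"
  using polyfun.mult[OF assms(1) polyfun.const[of I "l - k" 1]] assms(2) by simp

lemma polyfun_cong_coords:
  assumes "polyfun I k p" "\<And>i. i \<in> I \<Longrightarrow> x i = y i"
  shows "p x = p y"
  using assms by induction auto

lemma polyfun_sum:
  assumes "\<And>a. a \<in> A \<Longrightarrow> polyfun I k (p a)"
  shows "polyfun I k (\<lambda>x. \<Sum>a\<in>A. p a x)"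
  using assms by (induction A rule: infinite_finite_induct) (auto intro: polyfun.intros)

lemma polyfun_prod:
  assumes "finite A" "\<And>a. a \<in> A \<Longrightarrow> polyfun I k (p a)"
  shows "polyfun I (card A * k) (\<lambda>x. \<Prod>a\<in>A. p a x)"
  using assms by (induction A rule: finite_induct) (auto intro: polyfun.intros)

lemma polyfun_compose:
  assumes "polyfun J k p" "\<And>j. j \<in> J \<Longrightarrow> polyfun I l (G j)"
  shows "polyfun I (k * l) (\<lambda>x. p (\<lambda>j. G j x))"
  using assms
proof induction
  case (coord j k)
  then show ?case using polyfun_mono[of I l "G j" "Suc k * l"] by simp
next
  case (mult k p l' q)
  then show ?case using polyfun.mult[of I "k * l" _ "l' * l"] by (simp add: algebra_simps)
qed (auto intro: polyfun.intros)

text \<open>Restriction to a line reduces questions about zeros to root counts for a univariate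
  polynomial with the same degree bound.\<close>

lemma polyfun_on_line:
  assumes "polyfun I k p"
  shows "\<exists>c. degree c \<le> k \<and> (\<forall>s. p (\<lambda>i. x i + s * y i) = poly c s)"
  using assms
proof induction
  case (const k c)
  then show ?case by (intro exI[of _ "[:c:]"]) auto
next
  case (coord i k)
  then show ?case by (intro exI[of _ "[:x i, y i:]"]) (auto simp: degree_pCons_le)
next
  case (add k p q)
  then obtain c c' where "degree c \<le> k" "\<forall>s. p (\<lambda>i. x i + s * y i) = poly c s"
    "degree c' \<le> k" "\<forall>s. q (\<lambda>i. x i + s * y i) = poly c' s" by blast
  then show ?case by (intro exI[of _ "c + c'"]) (auto intro: degree_add_le)
next
  case (mult k p l q)
  then obtain c c' where *: "degree c \<le> k" "\<forall>s. p (\<lambda>i. x i + s * y i) = poly c s"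
    "degree c' \<le> l" "\<forall>s. q (\<lambda>i. x i + s * y i) = poly c' s" by blast
  have "degree (c * c') \<le> k + l" using * degree_mult_le[of c c'] by linarith
  then show ?case using * by (intro exI[of _ "c * c'"]) auto
qed

lemma polyfun_line_finite_zeros:
  assumes "polyfun I k p" "p (\<lambda>i. x i + s0 * y i) \<noteq> 0"
  shows "finite {s. p (\<lambda>i. x i + s * y i) = 0}"
proof -
  obtain c where c: "\<forall>s. p (\<lambda>i. x i + s * y i) = poly c s"
    using polyfun_on_line[OF assms(1)] by blast
  with assms(2) have "c \<noteq> 0" by auto
  then show ?thesis using c poly_roots_finite[of c] by simp
qed

text \<open>On the line through \<open>x\<close> and \<open>y\<close> each factor has finitely many
  zeros, and the field is infinite.\<close>

lemma polyfun_mult_nonzero: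
  fixes p q :: "('a \<Rightarrow> 'b::field_char_0) \<Rightarrow> 'b"
  assumes "polyfun I k p" "polyfun I l q" "p x \<noteq> 0" "q y \<noteq> 0"
  shows "\<exists>z. p z * q z \<noteq> 0"
proof -
  have "finite ({s. p (\<lambda>i. x i + s * (y i - x i)) = 0} \<union> {s. q (\<lambda>i. x i + s * (y i - x i)) = 0})"
    using polyfun_line_finite_zeros[OF assms(1), of x 0 "\<lambda>i. y i - x i"]
      polyfun_line_finite_zeros[OF assms(2), of x 1 "\<lambda>i. y i - x i"] assms(3,4) by simp
  then obtain s where "p (\<lambda>i. x i + s * (y i - x i)) \<noteq> 0" "q (\<lambda>i. x i + s * (y i - x i)) \<noteq> 0"
    using ex_new_if_finite[OF infinite_UNIV_char_0] by blast
  then show ?thesis by auto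
qed

lemma polyfun_prod_nonzero:
  fixes p :: "'c \<Rightarrow> ('a \<Rightarrow> 'b::field_char_0) \<Rightarrow> 'b"
  assumes "finite A" "\<And>a. a \<in> A \<Longrightarrow> \<exists>k. polyfun I k (p a)" "\<And>a. a \<in> A \<Longrightarrow> \<exists>x. p a x \<noteq> 0"
  shows "\<exists>k. polyfun I k (\<lambda>x. \<Prod>a\<in>A. p a x) \<and> (\<exists>x. (\<Prod>a\<in>A. p a x) \<noteq> 0)"
  using assms
proof (induction A rule: finite_induct)
  case empty
  then show ?case by (auto intro: polyfun.intros)
next
  case (insert a A)
  then obtain k l where k: "polyfun I k (p a)" and l: "polyfun I l (\<lambda>x. \<Prod>a\<in>A. p a x)"
      "\<exists>x. (\<Prod>a\<in>A. p a x) \<noteq> 0" by blast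
  moreover have "\<exists>x. p a x \<noteq> 0" using insert.prems by blast
  ultimately have "\<exists>z. p a z * (\<Prod>a\<in>A. p a z) \<noteq> 0"
    using polyfun_mult_nonzero[OF k l(1)] by blast
  then show ?case using polyfun.mult[OF k l(1)] insert.hyps by auto
qed

text \<open>The coordinates in \<open>A\<close> are released one at a time: in each of them
  \<open>p\<close> has degree at most \<open>k\<close> but vanishes at the \<open>k + 1\<close>
  values 0, ..., k. Coordinates outside \<open>A\<close> are unrestricted from the start.\<close>

lemma polyfun_zero_on_grid:
  fixes p :: "('a \<Rightarrow> 'b::field_char_0) \<Rightarrow> 'b"
  assumes p: "polyfun I k p" and "finite A"
    and "\<And>x. (\<And>i. i \<in> A \<Longrightarrow> x i \<in> of_nat ` {..k}) \<Longrightarrow> p x = 0"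
  shows "p x = 0"
  using assms(2,3)
proof (induction A arbitrary: x rule: finite_induct)
  case empty
  then show ?case by simp
next
  case (insert a A)
  have "p y = 0" if y: "\<And>i. i \<in> A \<Longrightarrow> y i \<in> of_nat ` {..k}" for y
  proof -
    define e where "e = (\<lambda>i. if i = a then 1 else 0 :: 'b)"
    obtain c where c: "degree c \<le> k" "\<forall>s. p (\<lambda>i. (y(a := 0)) i + s * e i) = poly c s"
      using polyfun_on_line[OF p] by blast
    have upd: "(\<lambda>i. (y(a := 0)) i + s * e i) = y(a := s)" for s by (auto simp: e_def)
    have "poly c s = 0" if "s \<in> of_nat ` {..k}" for s
    proof -
      have "p (y(a := s)) = 0"
        by (rule insert.prems) (use insert.hyps y that in \<open>auto split: if_splits\<close>)
      then show ?thesis using c(2) upd by metis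
    qed
    then have "of_nat ` {..k} \<subseteq> {s. poly c s = 0}" by blast
    moreover have "card (of_nat ` {..k} :: 'b set) = Suc k"
      by (subst card_image) (auto simp: inj_on_def)
    ultimately have "c \<noteq> 0 \<Longrightarrow> Suc k \<le> card {s. poly c s = 0}"
      using card_mono[OF poly_roots_finite[of c], of "of_nat ` {..k}"] by simp
    then have "c = 0" using card_poly_roots_bound[of c] c(1) by linarith
    then have "p (y(a := y a)) = 0" using c(2)[rule_format, of "y a"] unfolding upd by simp
    then show ?thesis by simp
  qed
  then show ?case using insert.IH by blast
qed

text \<open>On the line through Re z with direction Im z, real parameters give real points, where
  \<open>p\<close> vanishes, while the parameter \<i> gives \<open>z\<close>.\<close>

lemma polyfun_zero_of_real_points:
  fixes p :: "('a \<Rightarrow> complex) \<Rightarrow> complex"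
  assumes "polyfun I k p" "\<And>x :: 'a \<Rightarrow> real. p (\<lambda>i. of_real (x i)) = 0"
  shows "p z = 0"
proof (rule ccontr)
  assume "p z \<noteq> 0"
  then have "p (\<lambda>i. of_real (Re (z i)) + \<i> * of_real (Im (z i))) \<noteq> 0"
    using complex_eq by simp
  from polyfun_line_finite_zeros[OF assms(1) this]
  have "finite {s. p (\<lambda>i. of_real (Re (z i)) + s * of_real (Im (z i))) = 0}" .
  moreover have "range of_real \<subseteq> {s. p (\<lambda>i. of_real (Re (z i)) + s * of_real (Im (z i))) = 0}"
    using assms(2)[of "\<lambda>i. Re (z i) + s * Im (z i)" for s] by auto
  ultimately have "finite (range (of_real :: real \<Rightarrow> complex))" using finite_subset by blast
  then show False using finite_imageD[of of_real "UNIV :: real set"] infinite_UNIV_char_0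
    by (auto simp: inj_on_def)
qed

lemma polyfun_complexify:
  fixes p :: "('a \<Rightarrow> real) \<Rightarrow> real"
  assumes "polyfun I k p"
  shows "\<exists>q :: ('a \<Rightarrow> complex) \<Rightarrow> complex. polyfun I k q \<and> (\<forall>x. q (\<lambda>i. of_real (x i)) = of_real (p x))"
  using assms
proof induction
  case (const k c)
  then show ?case by (intro exI[of _ "\<lambda>x. of_real c"]) (auto intro: polyfun.intros)
next
  case (coord i k)
  then show ?case by (intro exI[of _ "\<lambda>x. x i"]) (auto intro: polyfun.intros)
next
  case (add k p q)
  then obtain p' q' where "polyfun I k p'" "\<forall>x. p' (\<lambda>i. of_real (x i)) = complex_of_real (p x)"
    "polyfun I k q'" "\<forall>x. q' (\<lambda>i. of_real (x i)) = complex_of_real (q x)" by blast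
  then show ?case by (intro exI[of _ "\<lambda>x. p' x + q' x"]) (auto intro: polyfun.intros)
next
  case (mult k p l q)
  then obtain p' q' where "polyfun I k p'" "\<forall>x. p' (\<lambda>i. of_real (x i)) = complex_of_real (p x)"
    "polyfun I l q'" "\<forall>x. q' (\<lambda>i. of_real (x i)) = complex_of_real (q x)" by blast
  then show ?case by (intro exI[of _ "\<lambda>x. p' x * q' x"]) (auto intro: polyfun.intros)
qed

section \<open>Algebraic independence and generic submersions\<close>

text \<open>Stating the chain rule along all curves avoids a norm on the function space and any
  differentiability outside \<open>I\<close>; moving a single coordinate recovers the partial
  derivatives.\<close>

definition is_gradient :: "'a set \<Rightarrow> (('a \<Rightarrow> real) \<Rightarrow> real) \<Rightarrow> ('a \<Rightarrow> ('a \<Rightarrow> real) \<Rightarrow> real) \<Rightarrow> bool" where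
  "is_gradient I p p' \<longleftrightarrow>
    (\<forall>\<gamma> \<gamma>' s. (\<forall>i\<in>I. ((\<lambda>s. \<gamma> s i) has_real_derivative \<gamma>' i) (at s)) \<longrightarrow>
      ((\<lambda>s. p (\<gamma> s)) has_real_derivative (\<Sum>i\<in>I. p' i (\<gamma> s) * \<gamma>' i)) (at s))"

lemma is_gradientD:
  assumes "is_gradient I p p'" "\<And>i. i \<in> I \<Longrightarrow> ((\<lambda>s. \<gamma> s i) has_real_derivative \<gamma>' i) (at s)"
  shows "((\<lambda>s. p (\<gamma> s)) has_real_derivative (\<Sum>i\<in>I. p' i (\<gamma> s) * \<gamma>' i)) (at s)"
  using assms(1)[unfolded is_gradient_def, THEN spec[of _ \<gamma>], THEN spec[of _ \<gamma>'], THEN spec[of _ s]]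
  by (rule mp) (intro ballI assms(2))

text \<open>The drop of the bound drives the minimal-degree argument below. Since
  \<open>k - 1\<close> is truncated at 0, the drop from \<open>k = 0\<close> is expressed by the
  clause that the gradient vanishes; the product rule relies on this clause when one factor has
  bound 0.\<close>

lemma polyfun_gradient:
  fixes p :: "('a \<Rightarrow> real) \<Rightarrow> real"
  assumes "polyfun I k p" "finite I"
  shows "\<exists>p'. (\<forall>i. polyfun I (k - 1) (p' i)) \<and> (k = 0 \<longrightarrow> (\<forall>i x. p' i x = 0)) \<and>
    is_gradient I p p'"
  using assms
proof induction
  case (const k c)
  then show ?case by (intro exI[of _ "\<lambda>i x. 0"]) (auto simp: is_gradient_def intro: polyfun.intros)
next
  case (coord j k)
  have "polyfun I (Suc k - 1) (\<lambda>x. if i = j then 1 else 0)" for i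
    by (cases "i = j") (auto intro: polyfun.intros)
  moreover have "(\<Sum>i\<in>I. (if i = j then 1 else 0) * c i) = (c j :: real)" for c
    using coord by (simp add: if_distrib[where f = "\<lambda>a. a * _"] sum.delta cong: if_cong)
  ultimately show ?case using coord(1)
    by (intro exI[of _ "\<lambda>i x. if i = j then 1 else 0"]) (auto simp: is_gradient_def intro: polyfun.const)
next
  case (add k p q)
  then obtain p' q' where p': "\<forall>i. polyfun I (k - 1) (p' i)" "k = 0 \<longrightarrow> (\<forall>i x. p' i x = 0)" "is_gradient I p p'"
    and q': "\<forall>i. polyfun I (k - 1) (q' i)" "k = 0 \<longrightarrow> (\<forall>i x. q' i x = 0)" "is_gradient I q q'"
    by blast
  have "is_gradient I (\<lambda>x. p x + q x) (\<lambda>i x. p' i x + q' i x)"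
    unfolding is_gradient_def
  proof (intro allI impI)
    fix \<gamma> \<gamma>' s assume deriv: "\<forall>i\<in>I. ((\<lambda>s. \<gamma> s i) has_real_derivative \<gamma>' i) (at s)"
    show "((\<lambda>s. p (\<gamma> s) + q (\<gamma> s)) has_real_derivative
      (\<Sum>i\<in>I. (p' i (\<gamma> s) + q' i (\<gamma> s)) * \<gamma>' i)) (at s)"
      using DERIV_add[OF is_gradientD[OF p'(3), of \<gamma> \<gamma>' s] is_gradientD[OF q'(3), of \<gamma> \<gamma>' s]] deriv
      by (simp add: distrib_right sum.distrib)
  qed
  then show ?case using p'(1,2) q'(1,2)
    by (intro exI[of _ "\<lambda>i x. p' i x + q' i x"]) (auto intro: polyfun.intros)
next
  case (mult k p l q)
  then obtain p' q' where p': "\<forall>i. polyfun I (k - 1) (p' i)" "k = 0 \<longrightarrow> (\<forall>i x. p' i x = 0)" "is_gradient I p p'"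
    and q': "\<forall>i. polyfun I (l - 1) (q' i)" "l = 0 \<longrightarrow> (\<forall>i x. q' i x = 0)" "is_gradient I q q'"
    by blast
  have "is_gradient I (\<lambda>x. p x * q x) (\<lambda>i x. p' i x * q x + p x * q' i x)"
    unfolding is_gradient_def
  proof (intro allI impI)
    fix \<gamma> \<gamma>' s assume deriv: "\<forall>i\<in>I. ((\<lambda>s. \<gamma> s i) has_real_derivative \<gamma>' i) (at s)"
    show "((\<lambda>s. p (\<gamma> s) * q (\<gamma> s)) has_real_derivative
      (\<Sum>i\<in>I. (p' i (\<gamma> s) * q (\<gamma> s) + p (\<gamma> s) * q' i (\<gamma> s)) * \<gamma>' i)) (at s)"
    proof -
      have "(\<Sum>i\<in>I. (p' i (\<gamma> s) * q (\<gamma> s) + p (\<gamma> s) * q' i (\<gamma> s)) * \<gamma>' i) =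
        (\<Sum>i\<in>I. p' i (\<gamma> s) * \<gamma>' i) * q (\<gamma> s) + (\<Sum>i\<in>I. q' i (\<gamma> s) * \<gamma>' i) * p (\<gamma> s)"
        by (simp add: algebra_simps sum.distrib sum_distrib_left)
      then show ?thesis
        using DERIV_mult[OF is_gradientD[OF p'(3) deriv[rule_format]] is_gradientD[OF q'(3) deriv[rule_format]]]
        by (simp only:)
    qed
  qed
  moreover have "polyfun I (k + l - 1) (\<lambda>x. p' i x * q x + p x * q' i x)" for i
  proof (rule polyfun.add)
    show "polyfun I (k + l - 1) (\<lambda>x. p' i x * q x)"
    proof (cases k)
      case 0
      then show ?thesis using p'(2) by (auto intro: polyfun.intros)
    next
      case (Suc k')
      then show ?thesis using polyfun.mult[OF p'(1)[rule_format, of i] mult.hyps(2)] by simp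
    qed
    show "polyfun I (k + l - 1) (\<lambda>x. p x * q' i x)"
    proof (cases l)
      case 0
      then show ?thesis using q'(2) by (auto intro: polyfun.intros)
    next
      case (Suc l')
      then show ?thesis using polyfun.mult[OF mult.hyps(1) q'(1)[rule_format, of i]] by simp
    qed
  qed
  ultimately show ?case using p'(2) q'(2)
    by (intro exI[of _ "\<lambda>i x. p' i x * q x + p x * q' i x"]) auto
qed

section \<open>Algebraic independence and the Jacobian criterion\<close>

definition alg_independent :: "'k set \<Rightarrow> ('k \<Rightarrow> ('a \<Rightarrow> 'b::field) \<Rightarrow> 'b) \<Rightarrow> bool" where
  "alg_independent K G \<longleftrightarrow>
     (\<forall>k p. polyfun K k p \<and> (\<forall>x. p (\<lambda>j. G j x) = 0) \<longrightarrow> (\<forall>y. p y = 0))"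

lemma alg_independentD:
  assumes "alg_independent K G" "polyfun K k p" "\<And>x. p (\<lambda>j. G j x) = 0"
  shows "p y = 0"
  using assms(1)[unfolded alg_independent_def, THEN spec[of _ k], THEN spec[of _ p]] assms(2,3) by simp

text \<open>
  Count dimensions: the products of Lagrange polynomials on the grid \<open>{0..k}\<close> give
  \<open>(k + 1) ^ card K\<close> linearly independent candidates for a relation, whereas a polynomial in the
  variables \<open>I\<close> vanishes as soon as it does on a grid with \<open>O(k ^ card I)\<close> points.
\<close>

lemma alg_independent_card_le:
  fixes G :: "'k \<Rightarrow> ('a \<Rightarrow> 'b::field_char_0) \<Rightarrow> 'b"
  assumes indep: "alg_independent K G" and "finite K" "finite I"
    and G: "\<And>j. j \<in> K \<Longrightarrow> polyfun I D (G j)"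
  shows "card K \<le> card I"
proof (rule ccontr)
  assume "\<not> card K \<le> card I"
  then have less: "card I < card K" by simp
  \<comment> \<open>\<open>L\<close> bounds the degree of a combination of Lagrange products
    composed with \<open>G\<close>. The constants give \<open>Suc L \<le> Suc k * M\<close> and
    \<open>M ^ card I = k < Suc k\<close>, so that
    \<open>Suc L ^ card I < Suc k ^ Suc (card I)\<close>: fewer test points than candidates.\<close>
  define M where "M = Suc (card K * Suc D)"
  define k where "k = M ^ card I"
  define L where "L = k * (card K * Suc D)"
  define U where "U = PiE K (\<lambda>_. {..k})"
  define E where "E = PiE I (\<lambda>_. {..L})"
  have fin: "finite U" "finite E" using assms by (auto simp: U_def E_def intro: finite_PiE)
  have "Suc L \<le> Suc k * M" by (simp add: L_def M_def)
  then have "Suc L ^ card I \<le> Suc k ^ card I * M ^ card I"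
    by (metis power_mono power_mult_distrib le0)
  also have "\<dots> < Suc k ^ card I * Suc k" by (simp add: k_def)
  also have "\<dots> = Suc k ^ Suc (card I)" by simp
  also have "\<dots> \<le> Suc k ^ card K" using less by (intro power_increasing) auto
  finally have "card E < card U"
    using assms by (simp add: U_def E_def card_PiE)
  \<comment> \<open>Unnormalized Lagrange products: on the grid \<open>U\<close>,
    \<open>lag u\<close> is nonzero exactly at \<open>u\<close>. Hence a combination with
    \<open>c u \<noteq> 0\<close> is nonzero at \<open>u\<close>.\<close>
  define lag where "lag u y = (\<Prod>j\<in>K. \<Prod>e\<in>{..k} - {u j}. y j - of_nat e)"
    for u :: "'k \<Rightarrow> nat" and y :: "'k \<Rightarrow> 'b"
  \<comment> \<open>One unknown per candidate and one equation per point of \<open>E\<close>: the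
    combination is to vanish on \<open>G\<close> at every grid point.\<close>
  obtain c where c: "\<exists>u\<in>U. c u \<noteq> 0"
      "\<forall>e\<in>E. (\<Sum>u\<in>U. lag u (\<lambda>j. G j (\<lambda>i. of_nat (e i))) * c u) = 0"
    using underdetermined_system[OF fin(2,1) \<open>card E < card U\<close>,
        of "\<lambda>e u. lag u (\<lambda>j. G j (\<lambda>i. of_nat (e i)))"] by auto
  define p where "p y = (\<Sum>u\<in>U. lag u y * c u)" for y
  have lin: "polyfun K 1 (\<lambda>y. y j - of_nat e)" if "j \<in> K" for j e
    using polyfun.add[OF polyfun.coord[OF that, of 0] polyfun.const[of K "Suc 0" "- of_nat e"]] by simp
  have "polyfun K (card K * k) (lag u)" if "u \<in> U" for u
    unfolding lag_def
  proof (rule polyfun_prod)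
    fix j assume j: "j \<in> K"
    have "card ({..k} - {u j}) = k" using that j by (auto simp: U_def PiE_iff)
    then show "polyfun K k (\<lambda>y. \<Prod>e\<in>{..k} - {u j}. y j - of_nat e)"
      using polyfun_prod[OF _ lin[OF j], of "{..k} - {u j}" "\<lambda>e. e"] by simp
  qed fact
  then have p: "polyfun K (card K * k) p"
    unfolding p_def using polyfun.mult[OF _ polyfun.const[of K 0]]
    by (intro polyfun_sum) fastforce
  have "polyfun I (card K * k * D) (\<lambda>x. p (\<lambda>j. G j x))"
    by (rule polyfun_compose[OF p G])
  then have pG: "polyfun I L (\<lambda>x. p (\<lambda>j. G j x))"
    by (rule polyfun_mono) (simp add: L_def)
  have "p (\<lambda>j. G j x) = 0" for x
  proof (rule polyfun_zero_on_grid[OF pG \<open>finite I\<close>])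
    fix x :: "'a \<Rightarrow> 'b" assume x: "\<And>i. i \<in> I \<Longrightarrow> x i \<in> of_nat ` {..L}"
    then have "\<forall>i\<in>I. \<exists>n. n \<le> L \<and> x i = of_nat n" by fastforce
    then obtain e where e: "\<And>i. i \<in> I \<Longrightarrow> e i \<le> L \<and> x i = of_nat (e i)" by metis
    have "restrict e I \<in> E" using e by (auto simp: E_def)
    then have "p (\<lambda>j. G j (\<lambda>i. of_nat (restrict e I i))) = 0"
      unfolding p_def using c(2) by blast
    moreover have "p (\<lambda>j. G j x) = p (\<lambda>j. G j (\<lambda>i. of_nat (restrict e I i)))"
      by (rule polyfun_cong_coords[OF pG]) (simp add: e)
    ultimately show "p (\<lambda>j. G j x) = 0" by simp
  qed
  then have p0: "p y = 0" for y using alg_independentD[OF indep p] by blast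
  obtain u where u: "u \<in> U" "c u \<noteq> 0" using c(1) by blast
  have "lag v (\<lambda>j. of_nat (u j)) = 0" if v: "v \<in> U" "v \<noteq> u" for v
  proof -
    obtain j where j: "j \<in> K" "u j \<noteq> v j" using v u by (metis PiE_ext U_def)
    have "u j \<le> k" using u j by (auto simp: U_def PiE_iff)
    then have "(\<Prod>e\<in>{..k} - {v j}. of_nat (u j) - of_nat e :: 'b) = 0"
      using j by (intro prod_zero) auto
    then show ?thesis unfolding lag_def using j \<open>finite K\<close> by (intro prod_zero) auto
  qed
  then have "p (\<lambda>j. of_nat (u j)) = lag u (\<lambda>j. of_nat (u j)) * c u"
    unfolding p_def using fin(1) u(1) by (subst sum.remove[of U u]) auto
  moreover have "lag u (\<lambda>j. of_nat (u j)) \<noteq> 0"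
    unfolding lag_def using \<open>finite K\<close> by auto
  ultimately show False using p0 u(2) by simp
qed

text \<open>Bordering the matrix by the column \<open>y\<close> gives more unknowns than equations,
  hence a nontrivial kernel vector. By injectivity its entry at \<open>y\<close> is nonzero, and
  dividing by it solves the system.\<close>

lemma injective_imp_surjective_matrix:
  fixes a :: "'k \<Rightarrow> 'i \<Rightarrow> 'b::field"
  assumes "finite K" "finite I" "card K \<le> card I"
    and inj: "\<And>v i. (\<forall>k\<in>K. (\<Sum>i\<in>I. a k i * v i) = 0) \<Longrightarrow> i \<in> I \<Longrightarrow> v i = 0"
  shows "\<exists>v. \<forall>k\<in>K. (\<Sum>i\<in>I. a k i * v i) = y k"
proof -
  define a' where "a' k u = (case u of None \<Rightarrow> y k | Some i \<Rightarrow> a k i)" for k u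
  define U where "U = insert None (Some ` I)"
  have "card U = Suc (card I)" "finite U"
    using assms by (auto simp: U_def card_image)
  then obtain c where c: "\<exists>u\<in>U. c u \<noteq> 0" "\<forall>k\<in>K. (\<Sum>u\<in>U. a' k u * c u) = 0"
    using underdetermined_system[of K U a'] assms by auto
  have eq: "y k * c None + (\<Sum>i\<in>I. a k i * c (Some i)) = 0" if "k \<in> K" for k
    using c(2) that \<open>finite I\<close> by (simp add: U_def a'_def sum.reindex)
  have "c None \<noteq> 0"
  proof
    assume "c None = 0"
    then have "c (Some i) = 0" if "i \<in> I" for i
      using inj[of "\<lambda>i. c (Some i)"] eq that by simp
    then show False using c(1) \<open>c None = 0\<close> by (auto simp: U_def)
  qed
  have "(\<Sum>i\<in>I. a k i * (- c (Some i) / c None)) = y k" if "k \<in> K" for k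
  proof -
    have "(\<Sum>i\<in>I. a k i * (- c (Some i) / c None)) = - (\<Sum>i\<in>I. a k i * c (Some i)) / c None"
      by (simp add: sum_negf sum_divide_distrib)
    also have "\<dots> = y k" using eq[OF that] \<open>c None \<noteq> 0\<close>
      by (simp add: add_eq_0_iff)
    finally show ?thesis .
  qed
  then show ?thesis by (intro exI[of _ "\<lambda>i. - c (Some i) / c None"]) blast
qed

text \<open>
  Take a relation of minimal degree: if the partial derivative in the new coordinate were again a
  relation, it would vanish identically, and the relation would not involve that coordinate.
\<close>

lemma dependent_coordinate_gradient:
  fixes G :: "'k \<Rightarrow> ('a \<Rightarrow> real) \<Rightarrow> real"
  assumes "finite K" and indep: "alg_independent K G" and dep: "\<not> alg_independent (insert z K) G"
  shows "\<exists>k p p'. (\<forall>x. p (\<lambda>j. G j x) = 0) \<and> is_gradient (insert z K) p p' \<and>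
    polyfun (insert z K) k (p' z) \<and> (\<exists>x. p' z (\<lambda>j. G j x) \<noteq> 0)"
proof -
  define Q where "Q k \<longleftrightarrow> (\<exists>p y. polyfun (insert z K) k p \<and> (\<forall>x. p (\<lambda>j. G j x) = 0) \<and> p y \<noteq> 0)" for k
  have "\<exists>k. Q k" using dep unfolding alg_independent_def Q_def by blast
  define k where "k = (LEAST k. Q k)"
  have "Q k" using \<open>\<exists>k. Q k\<close> unfolding k_def by (metis LeastI_ex)
  then obtain p y where p: "polyfun (insert z K) k p" "\<forall>x. p (\<lambda>j. G j x) = 0" "p y \<noteq> 0"
    unfolding Q_def by blast
  obtain p' where p': "\<forall>i. polyfun (insert z K) (k - 1) (p' i)" "k = 0 \<longrightarrow> (\<forall>i x. p' i x = 0)"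
      "is_gradient (insert z K) p p'"
    using polyfun_gradient[OF p(1)] \<open>finite K\<close> by blast
  have "\<exists>x. p' z (\<lambda>j. G j x) \<noteq> 0"
  proof (rule ccontr)
    assume a: "\<nexists>x. p' z (\<lambda>j. G j x) \<noteq> 0"
    \<comment> \<open>For \<open>k > 0\<close> the bound \<open>k - 1\<close> contradicts minimality
      unless the partial derivative is identically zero; for \<open>k = 0\<close> the gradient is
      zero anyway.\<close>
    have p'0: "p' z w = 0" for w
    proof (cases "k = 0")
      case False
      then have "\<not> Q (k - 1)" using not_less_Least[of "k - 1" Q] by (simp add: k_def)
      then show ?thesis using a p'(1) unfolding Q_def by blast
    qed (use p'(2) in auto)
    have p_upd: "p (w(z := 0)) = p w" for w
    proof -
      have "((\<lambda>s. p (w(z := s))) has_real_derivative 0) (at s)" for s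
      proof -
        have "((\<lambda>s. p (w(z := s))) has_real_derivative
            (\<Sum>i\<in>insert z K. p' i (w(z := s)) * (if i = z then 1 else 0))) (at s)"
          by (rule is_gradientD[OF p'(3)]) auto
        moreover have "(\<Sum>i\<in>insert z K. p' i (w(z := s)) * (if i = z then 1 else 0)) = 0"
          by (intro sum.neutral) (auto simp: p'0)
        ultimately show ?thesis by (simp only:)
      qed
      then have "p (w(z := 0)) = p (w(z := w z))"
        using DERIV_isconst_all[of "\<lambda>s. p (w(z := s))"] by blast
      then show ?thesis by simp
    qed
    \<comment> \<open>Setting the coordinate \<open>z\<close> to 0 turns the relation into one among
      the coordinates \<open>K\<close> only.\<close>
    define H where "H j w = (if j = z then 0 else w j)" for j and w :: "'k \<Rightarrow> real"
    have "polyfun K 1 (H j)" if "j \<in> insert z K" for j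
      using that polyfun.coord[of j K 0] polyfun.const[of K 1 0]
      by (cases "j = z") (auto simp: H_def[abs_def])
    from polyfun_compose[OF p(1) this] have "polyfun K (k * 1) (\<lambda>w. p (\<lambda>j. H j w))" .
    moreover have "(\<lambda>j. H j w) = w(z := 0)" for w by (auto simp: H_def)
    ultimately have "polyfun K (k * 1) (\<lambda>w. p (w(z := 0)))" by simp
    then have "p (y(z := 0)) = 0"
      using alg_independentD[OF indep] p(2) p_upd by simp
    then show False using p(3) p_upd by simp
  qed
  then show ?thesis using p(2) p'(1,3) by blast
qed

text \<open>
  The Jacobian criterion. Complete \<open>f\<close> by a maximal set \<open>S\<close> of coordinates to an independent family; the
  remaining coordinates satisfy minimal relations, and differentiating these shows that the
  Jacobian matrix of the completed family is injective wherever certain partial derivatives of the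
  relations do not vanish. It is at most square, hence surjective.
\<close>

lemma alg_independent_imp_generic_submersion:
  fixes f :: "'j \<Rightarrow> ('i \<Rightarrow> real) \<Rightarrow> real"
  assumes "finite I" "finite J" and indep: "alg_independent J f"
    and f: "\<And>j. j \<in> J \<Longrightarrow> polyfun I D (f j)"
  obtains k g where "polyfun I k g" "\<exists>x. g x \<noteq> 0"
    "\<And>x f' y. g x \<noteq> 0 \<Longrightarrow>
      (\<And>j v. j \<in> J \<Longrightarrow> ((\<lambda>s. f j (\<lambda>i. x i + s * v i)) has_real_derivative (\<Sum>i\<in>I. f' j i * v i)) (at 0)) \<Longrightarrow>
      \<exists>v. \<forall>j\<in>J. (\<Sum>i\<in>I. f' j i * v i) = y j"
proof -
  \<comment> \<open>One family on a sum type: \<open>Inl\<close> for the given polynomials,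
    \<open>Inr\<close> for the coordinate functions.\<close>
  define G where "G z x = (case z of Inl j \<Rightarrow> f j x | Inr i \<Rightarrow> x i)" for z and x :: "'i \<Rightarrow> real"
  define K where "K S = Inl ` J \<union> Inr ` S" for S :: "'i set"
  have finK: "finite (K S)" if "S \<subseteq> I" for S
    using that assms(1,2) finite_subset by (auto simp: K_def)
  have polyG: "polyfun I (Suc D) (G z)" if z: "z \<in> K S" and S: "S \<subseteq> I" for z S
  proof (cases z)
    case (Inl j)
    then have "polyfun I (Suc D) (f j)" using z polyfun_mono[OF f[of j], of "Suc D"] by (auto simp: K_def)
    then show ?thesis using Inl by (simp add: G_def[abs_def])
  next
    case (Inr i)
    then have "i \<in> I" using z S by (auto simp: K_def)
    then show ?thesis using Inr polyfun.coord[of i I D] by (simp add: G_def[abs_def])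
  qed
  have ind0: "alg_independent (K {}) G"
    unfolding alg_independent_def
  proof (intro allI impI, elim conjE)
    fix k p and y :: "'j + 'i \<Rightarrow> real"
    assume p: "polyfun (K {}) k p" "\<forall>x. p (\<lambda>j. G j x) = 0"
    define H where "H z y = (case z of Inl j \<Rightarrow> y j | Inr i \<Rightarrow> 0)" for z :: "'j + 'i" and y :: "'j \<Rightarrow> real"
    have "polyfun J 1 (H z)" if "z \<in> K {}" for z
      using that polyfun.coord[of _ J 0] by (auto simp: H_def[abs_def] K_def)
    from polyfun_compose[OF p(1) this] have pH: "polyfun J (k * 1) (\<lambda>y. p (\<lambda>z. H z y))" .
    have "p (\<lambda>z. H z (\<lambda>j. f j x)) = p (\<lambda>z. G z x)" for x
      by (rule polyfun_cong_coords[OF p(1)]) (auto simp: H_def G_def K_def)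
    then have "p (\<lambda>z. H z (\<lambda>j. y (Inl j))) = 0"
      using alg_independentD[OF indep pH] p(2) by simp
    moreover have "p (\<lambda>z. H z (\<lambda>j. y (Inl j))) = p y"
      by (rule polyfun_cong_coords[OF p(1)]) (auto simp: H_def K_def)
    ultimately show "p y = 0" by simp
  qed
  define \<S> where "\<S> = {S. S \<subseteq> I \<and> alg_independent (K S) G}"
  have "finite \<S>" "\<S> \<noteq> {}" using \<open>finite I\<close> ind0 by (auto simp: \<S>_def)
  then obtain S where "S \<in> \<S>" and maxS: "\<forall>T\<in>\<S>. S \<subseteq> T \<longrightarrow> S = T"
    using finite_has_maximal[of \<S>] by blast
  then have S: "S \<subseteq> I" "alg_independent (K S) G" by (auto simp: \<S>_def)
  have cardK: "card (K S) \<le> card I"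
    using alg_independent_card_le[OF S(2) finK[OF S(1)] \<open>finite I\<close>] polyG[OF _ S(1)] by blast
  \<comment> \<open>\<open>W i h\<close>: where \<open>h\<close> does not vanish, a direction
    \<open>v\<close> along which the whole completed family has derivative 0 also has
    \<open>v i = 0\<close>. \<open>G' z\<close> is the derivative of \<open>G z\<close> along
    \<open>v\<close>.\<close>
  define W where "W i h \<longleftrightarrow> (\<forall>x G' v. h x \<noteq> 0 \<longrightarrow>
      (\<forall>z\<in>K I. ((\<lambda>s. G z (\<lambda>i. x i + s * v i)) has_real_derivative G' z) (at 0)) \<longrightarrow>
      (\<forall>z\<in>K S. G' z = 0) \<longrightarrow> G' (Inr i) = 0)"
    for i and h :: "('i \<Rightarrow> real) \<Rightarrow> real"
  have "\<exists>h. (\<exists>l. polyfun I l h) \<and> (\<exists>x. h x \<noteq> 0) \<and> W i h" if i: "i \<in> I - S" for i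
  proof -
    have Kins: "K (insert i S) = insert (Inr i) (K S)" by (auto simp: K_def)
    have "insert i S \<notin> \<S>" using maxS i by blast
    then have "\<not> alg_independent (insert (Inr i) (K S)) G" using i S(1) Kins by (simp add: \<S>_def)
    from dependent_coordinate_gradient[OF finK[OF S(1)] S(2) this]
    obtain k p p' where p: "\<forall>x. p (\<lambda>j. G j x) = 0" "is_gradient (insert (Inr i) (K S)) p p'"
      "polyfun (insert (Inr i) (K S)) k (p' (Inr i))" "\<exists>x. p' (Inr i) (\<lambda>j. G j x) \<noteq> 0" by blast
    have "polyfun I (k * Suc D) (\<lambda>x. p' (Inr i) (\<lambda>j. G j x))"
      using polyG[of _ "insert i S"] i S(1) Kins
      by (intro polyfun_compose[OF p(3)]) auto
    moreover have "G' (Inr i) = 0" if x: "p' (Inr i) (\<lambda>j. G j x) \<noteq> 0"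
      and G': "\<forall>z\<in>K I. ((\<lambda>s. G z (\<lambda>i. x i + s * v i)) has_real_derivative G' z) (at 0)"
      and G'0: "\<forall>z\<in>K S. G' z = 0" for x G' v
    proof -
      have sub: "insert (Inr i) (K S) \<subseteq> K I" using i S(1) by (auto simp: K_def)
      \<comment> \<open>The relation is constantly 0 along this curve. In its derivative all terms
        from \<open>K S\<close> vanish, leaving the partial derivative times the velocity of
        coordinate \<open>i\<close>.\<close>
      define \<gamma> where "\<gamma> s z = G z (\<lambda>i. x i + s * v i)" for s z
      have "((\<lambda>s. p (\<gamma> s)) has_real_derivative
          (\<Sum>z\<in>insert (Inr i) (K S). p' z (\<gamma> 0) * G' z)) (at 0)"
        by (rule is_gradientD[OF p(2)]) (use G' sub in \<open>auto simp: \<gamma>_def\<close>)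
      moreover have "(\<lambda>s. p (\<gamma> s)) = (\<lambda>s. 0)" using p(1) by (auto simp: \<gamma>_def[abs_def])
      ultimately have "(\<Sum>z\<in>insert (Inr i) (K S). p' z (\<gamma> 0) * G' z) = 0"
        using DERIV_unique[OF _ DERIV_const] by metis
      moreover have "(\<Sum>z\<in>insert (Inr i) (K S). p' z (\<gamma> 0) * G' z) = p' (Inr i) (\<gamma> 0) * G' (Inr i)"
        using i G'0 finK[OF S(1)] by (subst sum.insert) (auto simp: K_def)
      ultimately show ?thesis using x by (simp add: \<gamma>_def[abs_def])
    qed
    ultimately show ?thesis using p(4)
      unfolding W_def by (intro exI[of _ "\<lambda>x. p' (Inr i) (\<lambda>j. G j x)"]) blast
  qed
  then have "\<forall>i\<in>I - S. \<exists>h. (\<exists>l. polyfun I l h) \<and> (\<exists>x. h x \<noteq> 0) \<and> W i h" by blast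
  then obtain h where h: "\<forall>i\<in>I - S. (\<exists>l. polyfun I l (h i)) \<and> (\<exists>x. h i x \<noteq> 0) \<and> W i (h i)"
    by (rule bchoice[THEN exE])
  have "finite (I - S)" using \<open>finite I\<close> by simp
  \<comment> \<open>The product \<open>g\<close> of the \<open>h i\<close> is nonzero exactly where
    all coordinates outside \<open>S\<close> are controlled at once.\<close>
  then obtain k where g: "polyfun I k (\<lambda>x. \<Prod>i\<in>I - S. h i x)" "\<exists>x. (\<Prod>i\<in>I - S. h i x) \<noteq> 0"
    using polyfun_prod_nonzero[of "I - S" I h] h by blast
  show ?thesis
  proof (rule that[OF g])
    fix x f' y
    assume gx: "(\<Prod>i\<in>I - S. h i x) \<noteq> 0"
      and f': "\<And>j v. j \<in> J \<Longrightarrow> ((\<lambda>s. f j (\<lambda>i. x i + s * v i)) has_real_derivative (\<Sum>i\<in>I. f' j i * v i)) (at 0)"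
    define A where "A z i = (case z of Inl j \<Rightarrow> f' j i | Inr i' \<Rightarrow> if i = i' then 1 else 0)" for z i
    have AInr: "(\<Sum>i\<in>I. A (Inr i') i * v i) = v i'" if "i' \<in> I" for i' and v :: "'i \<Rightarrow> real"
    proof -
      have "(\<Sum>i\<in>I. A (Inr i') i * v i) = (\<Sum>i\<in>I. if i = i' then v i else 0)"
        by (rule sum.cong) (auto simp: A_def)
      then show ?thesis using that \<open>finite I\<close> by simp
    qed
    \<comment> \<open>The right-hand side is \<open>y\<close> on the given polynomials; on the
      auxiliary coordinates any value would serve, and 0 is taken.\<close>
    have "\<exists>v. \<forall>z\<in>K S. (\<Sum>i\<in>I. A z i * v i) = (case z of Inl j \<Rightarrow> y j | Inr i \<Rightarrow> 0)"
    proof (rule injective_imp_surjective_matrix[OF finK[OF S(1)] \<open>finite I\<close> cardK])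
      fix v i assume v: "\<forall>z\<in>K S. (\<Sum>i\<in>I. A z i * v i) = 0" and i: "i \<in> I"
      have "((\<lambda>s. G z (\<lambda>i. x i + s * v i)) has_real_derivative (\<Sum>i\<in>I. A z i * v i)) (at 0)"
        if z: "z \<in> K I" for z
      proof (cases z)
        case (Inl j)
        then show ?thesis using z f'[of j v] by (auto simp: G_def A_def K_def)
      next
        case (Inr i')
        then have "i' \<in> I" using z by (auto simp: K_def)
        have "((\<lambda>s. x i' + s * v i') has_real_derivative v i') (at 0)"
          by (auto intro!: derivative_eq_intros)
        then show ?thesis using Inr AInr[OF \<open>i' \<in> I\<close>] by (simp add: G_def)
      qed
      then have deriv: "\<forall>z\<in>K I. ((\<lambda>s. G z (\<lambda>i. x i + s * v i)) has_real_derivative (\<Sum>i\<in>I. A z i * v i)) (at 0)"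
        by blast
      have hx: "h i x \<noteq> 0" if "i \<in> I - S" using gx that \<open>finite I\<close> by auto
      have *: "(\<Sum>i'\<in>I. A (Inr i) i' * v i') = 0" if i: "i \<in> I - S"
      proof -
        have "W i (h i)" using h i by blast
        from this[unfolded W_def, rule_format, OF hx[OF i], of v "\<lambda>z. \<Sum>i\<in>I. A z i * v i"]
        show ?thesis using deriv v by blast
      qed
      show "v i = 0"
      proof (cases "i \<in> S")
        case True
        then have "Inr i \<in> K S" by (simp add: K_def)
        then show ?thesis using v AInr[OF i, of v] by fastforce
      qed (use * AInr[OF i] i in auto)
    qed
    then obtain v where v: "\<forall>z\<in>K S. (\<Sum>i\<in>I. A z i * v i) = (case z of Inl j \<Rightarrow> y j | Inr i \<Rightarrow> 0)"
      by blast
    have "(\<Sum>i\<in>I. f' j i * v i) = y j" if "j \<in> J" for j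
      using v[rule_format, of "Inl j"] that by (simp add: K_def A_def)
    then show "\<exists>v. \<forall>j\<in>J. (\<Sum>i\<in>I. f' j i * v i) = y j" by blast
  qed
qed

section \<open>Quadratic maps\<close>

text \<open>On the full function space this is only a seminorm: coordinates outside \<open>I\<close>
  are ignored, which is why truncated vectors occur below.\<close>

definition l1norm :: "'a set \<Rightarrow> ('a \<Rightarrow> real) \<Rightarrow> real" where
  "l1norm I x = (\<Sum>i\<in>I. \<bar>x i\<bar>)"

lemma l1norm_nonneg [simp]: "0 \<le> l1norm I x"
  by (simp add: l1norm_def sum_nonneg)

lemma l1norm_triangle: "l1norm I (\<lambda>i. x i + y i) \<le> l1norm I x + l1norm I y"
  unfolding l1norm_def sum.distrib[symmetric] by (intro sum_mono) auto

lemma l1norm_scale: "l1norm I (\<lambda>i. c * x i) = \<bar>c\<bar> * l1norm I x"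
  by (simp add: l1norm_def abs_mult sum_distrib_left)

lemma l1norm_minus_commute: "l1norm I (\<lambda>i. x i - y i) = l1norm I (\<lambda>i. y i - x i)"
  by (simp add: l1norm_def abs_minus_commute)

lemma l1norm_cong: "(\<And>i. i \<in> I \<Longrightarrow> x i = y i) \<Longrightarrow> l1norm I x = l1norm I y"
  by (simp add: l1norm_def)

lemma abs_le_l1norm: "finite I \<Longrightarrow> i \<in> I \<Longrightarrow> \<bar>x i\<bar> \<le> l1norm I x"
  unfolding l1norm_def by (rule member_le_sum) auto

lemma l1norm_eq_0_iff: "finite I \<Longrightarrow> l1norm I x = 0 \<longleftrightarrow> (\<forall>i\<in>I. x i = 0)"
  unfolding l1norm_def by (subst sum_nonneg_eq_0_iff) auto

lemma l1norm_sum: "finite K \<Longrightarrow> l1norm I (\<lambda>i. \<Sum>k\<in>K. x k i) \<le> (\<Sum>k\<in>K. l1norm I (x k))"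
proof (induction K rule: finite_induct)
  case (insert k K)
  then show ?case using l1norm_triangle[of I "x k" "\<lambda>i. \<Sum>k\<in>K. x k i"] by simp
qed (simp add: l1norm_def)

lemma continuous_on_coord [continuous_intros]: "continuous_on S (\<lambda>x :: 'a \<Rightarrow> real. x i)"
  by (rule continuous_on_subset[OF continuous_on_product_coordinates]) simp

text \<open>Vanishing outside \<open>I\<close> makes the ball compact in the product
  topology.\<close>

definition l1ball :: "'a set \<Rightarrow> real \<Rightarrow> ('a \<Rightarrow> real) set" where
  "l1ball I R = {x. l1norm I x \<le> R \<and> (\<forall>i. i \<notin> I \<longrightarrow> x i = 0)}"

lemma compact_l1ball:
  assumes "finite I"
  shows "compact (l1ball I R)"
proof -
  define S where "S i = (if i \<in> I then {-R..R} else {0})" for i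
  have "compactin (product_topology (\<lambda>i. euclidean) UNIV) (PiE UNIV S)"
    by (simp add: compactin_PiE S_def)
  then have "compact (PiE UNIV S)" by (simp add: euclidean_product_topology)
  moreover have "closed {x. l1norm I x \<le> R}"
    unfolding l1norm_def by (intro closed_Collect_le continuous_intros)
  moreover have "l1ball I R = PiE UNIV S \<inter> {x. l1norm I x \<le> R}"
  proof -
    have "x i \<in> {-R..R}" if "l1norm I x \<le> R" "i \<in> I" for x i
      using abs_le_l1norm[OF assms that(2), of x] that(1) by auto
    moreover have "(\<forall>i. x i \<in> S i) \<longleftrightarrow> (\<forall>i\<in>I. x i \<in> {-R..R}) \<and> (\<forall>i. i \<notin> I \<longrightarrow> x i = 0)" for x
      unfolding S_def by (metis singleton_iff)
    ultimately show ?thesis unfolding l1ball_def PiE_UNIV_domain Pi_def by blast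
  qed
  ultimately show ?thesis by (simp add: compact_Int_closed)
qed

text \<open>A family of bilinear forms indexed by \<open>j\<close>, with coefficients
  \<open>c j\<close>. No symmetry is assumed, so the derivative of the quadratic map at
  \<open>x\<close> along \<open>v\<close> is B(x,v) + B(v,x).\<close>

definition bilinear_map :: "'i set \<Rightarrow> ('j \<Rightarrow> 'i \<Rightarrow> 'i \<Rightarrow> 'b) \<Rightarrow> ('i \<Rightarrow> 'b) \<Rightarrow> ('i \<Rightarrow> 'b) \<Rightarrow> 'j \<Rightarrow> 'b::field" where
  "bilinear_map I c x y j = (\<Sum>a\<in>I. \<Sum>b\<in>I. c j a b * (x a * y b))"

abbreviation quadratic_map :: "'i set \<Rightarrow> ('j \<Rightarrow> 'i \<Rightarrow> 'i \<Rightarrow> 'b) \<Rightarrow> ('i \<Rightarrow> 'b) \<Rightarrow> 'j \<Rightarrow> 'b::field" where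
  "quadratic_map I c x \<equiv> bilinear_map I c x x"

lemma bilinear_map_add_left: "bilinear_map I c (\<lambda>i. x i + x' i) y j = bilinear_map I c x y j + bilinear_map I c x' y j"
  by (simp add: bilinear_map_def algebra_simps sum.distrib)

lemma bilinear_map_add_right: "bilinear_map I c y (\<lambda>i. x i + x' i) j = bilinear_map I c y x j + bilinear_map I c y x' j"
  by (simp add: bilinear_map_def algebra_simps sum.distrib)

lemma bilinear_map_scale_left: "bilinear_map I c (\<lambda>i. s * x i) y j = s * bilinear_map I c x y j"
  by (simp add: bilinear_map_def algebra_simps sum_distrib_left)

lemma bilinear_map_scale_right: "bilinear_map I c y (\<lambda>i. s * x i) j = s * bilinear_map I c y x j"
  by (simp add: bilinear_map_def algebra_simps sum_distrib_left)

lemma bilinear_map_cong: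
  "(\<And>i. i \<in> I \<Longrightarrow> x i = x' i) \<Longrightarrow> (\<And>i. i \<in> I \<Longrightarrow> y i = y' i) \<Longrightarrow>
    bilinear_map I c x y j = bilinear_map I c x' y' j"
  by (simp add: bilinear_map_def)

lemma quadratic_map_scale: "quadratic_map I c (\<lambda>i. s * x i) j = s\<^sup>2 * quadratic_map I c x j"
  by (simp add: bilinear_map_scale_left bilinear_map_scale_right power2_eq_square)

lemma quadratic_map_add:
  "quadratic_map I c (\<lambda>i. x i + y i) j =
    quadratic_map I c x j + (bilinear_map I c x y j + bilinear_map I c y x j) + quadratic_map I c y j"
  by (simp add: bilinear_map_add_left bilinear_map_add_right)

lemma polyfun_quadratic_map: "polyfun I 2 (\<lambda>x. quadratic_map I c x j)"
proof -
  have "polyfun I (0 + (Suc 0 + Suc 0)) (\<lambda>x. c j a b * (x a * x b))" if "a \<in> I" "b \<in> I" for a b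
    using that by (intro polyfun.mult polyfun.const polyfun.coord)
  then show ?thesis
    unfolding bilinear_map_def by (intro polyfun_sum) (simp add: numeral_2_eq_2)
qed

lemma bilinear_map_bound:
  fixes c :: "'j \<Rightarrow> 'i \<Rightarrow> 'i \<Rightarrow> real"
  assumes "finite I" "finite J"
  shows "\<exists>C>0. \<forall>x y. l1norm J (bilinear_map I c x y) \<le> C * (l1norm I x * l1norm I y)"
proof -
  define C where "C = (\<Sum>j\<in>J. \<Sum>a\<in>I. \<Sum>b\<in>I. \<bar>c j a b\<bar>)"
  have "l1norm J (bilinear_map I c x y) \<le> C * (l1norm I x * l1norm I y)" for x y
  proof -
    have "l1norm J (bilinear_map I c x y) \<le> (\<Sum>j\<in>J. \<Sum>a\<in>I. \<Sum>b\<in>I. \<bar>c j a b * (x a * y b)\<bar>)"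
      unfolding l1norm_def bilinear_map_def
      by (intro sum_mono order_trans[OF sum_abs] order_refl)
    also have "\<dots> \<le> (\<Sum>j\<in>J. \<Sum>a\<in>I. \<Sum>b\<in>I. \<bar>c j a b\<bar> * (l1norm I x * l1norm I y))"
      unfolding abs_mult
      by (intro sum_mono mult_left_mono mult_mono abs_le_l1norm) (auto simp: assms)
    also have "\<dots> = C * (l1norm I x * l1norm I y)" by (simp add: C_def sum_distrib_right)
    finally show ?thesis .
  qed
  \<comment> \<open>\<open>C\<close> may be 0, so 1 is added to get a positive constant.\<close>
  moreover have "C * (l1norm I x * l1norm I y) \<le> (C + 1) * (l1norm I x * l1norm I y)" for x y
    by (intro mult_right_mono) auto
  moreover have "C \<ge> 0" by (auto simp: C_def intro!: sum_nonneg)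
  ultimately have "C + 1 > 0" "\<forall>x y. l1norm J (bilinear_map I c x y) \<le> (C + 1) * (l1norm I x * l1norm I y)"
    using order_trans by (linarith, blast)
  then show ?thesis by blast
qed

lemma continuous_on_bilinear_map [continuous_intros]:
  fixes c :: "'j \<Rightarrow> 'i \<Rightarrow> 'i \<Rightarrow> real"
  assumes "\<And>i. continuous_on S (\<lambda>w. f w i)" "\<And>i. continuous_on S (\<lambda>w. g w i)"
  shows "continuous_on S (\<lambda>w. bilinear_map I c (f w) (g w) j)"
  unfolding bilinear_map_def by (intro continuous_intros assms)

text \<open>The minimum over the compact unit sphere is positive by anisotropy, and homogeneity of
  degree 2 extends the bound. The sphere is empty only for empty \<open>I\<close>.\<close>

lemma anisotropic_quadratic_map_bound:
  fixes c :: "'j \<Rightarrow> 'i \<Rightarrow> 'i \<Rightarrow> real"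
  assumes I: "finite I" and J: "finite J"
    and aniso: "\<forall>x. (\<forall>j\<in>J. quadratic_map I c x j = 0) \<longrightarrow> (\<forall>i\<in>I. x i = 0)"
  shows "\<exists>\<mu>>0. \<forall>x. \<mu> * (l1norm I x)\<^sup>2 \<le> l1norm J (quadratic_map I c x)"
proof -
  define S where "S = {x. l1norm I x = 1} \<inter> l1ball I 1"
  have "closed {x. l1norm I x = 1}"
    unfolding l1norm_def by (intro closed_Collect_eq continuous_intros)
  then have "compact S" unfolding S_def using compact_l1ball[OF I]
    by (metis compact_Int_closed inf_commute)
  have "\<exists>\<mu>>0. \<forall>x\<in>S. \<mu> \<le> l1norm J (quadratic_map I c x)"
  proof (cases "S = {}")
    case True
    then show ?thesis by (auto intro: exI[of _ 1])
  next
    case False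
    have "continuous_on S (\<lambda>x. l1norm J (quadratic_map I c x))"
      unfolding l1norm_def by (intro continuous_intros)
    then obtain x where x: "x \<in> S" "\<forall>y\<in>S. l1norm J (quadratic_map I c x) \<le> l1norm J (quadratic_map I c y)"
      using continuous_attains_inf[OF \<open>compact S\<close> False] by blast
    have "l1norm J (quadratic_map I c x) \<noteq> 0"
    proof
      assume "l1norm J (quadratic_map I c x) = 0"
      then have "\<forall>i\<in>I. x i = 0" using aniso l1norm_eq_0_iff[OF J] by blast
      then show False using x(1) l1norm_eq_0_iff[OF I, of x] by (auto simp: S_def)
    qed
    then show ?thesis using x(2) by (intro exI[of _ "l1norm J (quadratic_map I c x)"]) (auto simp: less_le)
  qed
  then obtain \<mu> where \<mu>: "\<mu> > 0" "\<forall>x\<in>S. \<mu> \<le> l1norm J (quadratic_map I c x)" by blast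
  have "\<mu> * (l1norm I x)\<^sup>2 \<le> l1norm J (quadratic_map I c x)" for x
  proof (cases "l1norm I x = 0")
    case False
    define N where "N = l1norm I x"
    have N: "N > 0" using False by (simp add: N_def less_le)
    define z where "z i = (if i \<in> I then x i / N else 0)" for i
    have "l1norm I z = l1norm I (\<lambda>i. inverse N * x i)"
      by (rule l1norm_cong) (simp add: z_def field_simps)
    also have "\<dots> = 1" using N by (simp add: l1norm_scale flip: N_def)
    finally have "z \<in> S" by (auto simp: S_def l1ball_def z_def)
    then have "\<mu> \<le> l1norm J (quadratic_map I c z)" using \<mu> by blast
    moreover have "quadratic_map I c x = (\<lambda>j. N\<^sup>2 * quadratic_map I c z j)"
    proof
      fix j
      have "quadratic_map I c x j = quadratic_map I c (\<lambda>i. N * z i) j"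
        by (rule bilinear_map_cong) (use N in \<open>auto simp: z_def\<close>)
      then show "quadratic_map I c x j = N\<^sup>2 * quadratic_map I c z j"
        by (simp add: quadratic_map_scale)
    qed
    ultimately show ?thesis
      using N mult_left_mono[of \<mu> "l1norm J (quadratic_map I c z)" "N\<^sup>2"]
      by (simp add: l1norm_scale mult.commute flip: N_def)
  qed simp
  then show ?thesis using \<mu>(1) by blast
qed

text \<open>Properness: outside a ball of radius \<open>R\<close> the image stays at distance at
  least 1 from \<open>y\<close>; on the compact ball the distance attains its minimum, which is
  positive because \<open>y\<close> is not attained.\<close>

lemma anisotropic_quadratic_image_closed:
  fixes c :: "'j \<Rightarrow> 'i \<Rightarrow> 'i \<Rightarrow> real"
  assumes I: "finite I" and J: "finite J"
    and aniso: "\<forall>x. (\<forall>j\<in>J. quadratic_map I c x j = 0) \<longrightarrow> (\<forall>i\<in>I. x i = 0)"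
    and y: "\<nexists>x. \<forall>j\<in>J. quadratic_map I c x j = y j"
  shows "\<exists>\<epsilon>>0. \<forall>x. \<epsilon> \<le> l1norm J (\<lambda>j. quadratic_map I c x j - y j)"
proof -
  obtain \<mu> where \<mu>: "\<mu> > 0" "\<And>x. \<mu> * (l1norm I x)\<^sup>2 \<le> l1norm J (quadratic_map I c x)"
    using anisotropic_quadratic_map_bound[OF I J aniso] by blast
  \<comment> \<open>The first summand makes \<mu> R exceed the norm of \<open>y\<close> by at least
    1; the final 1 gives R \<ge> 1, so that the square of a norm larger than \<open>R\<close> is at
    least \<open>R\<close>.\<close>
  define R where "R = (l1norm J y + 1) / \<mu> + 1"
  have R: "R \<ge> 1" "\<mu> * R \<ge> l1norm J y + 1" using \<mu>(1) by (auto simp: R_def field_simps)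
  define e where "e x = l1norm J (\<lambda>j. quadratic_map I c x j - y j)" for x
  have "continuous_on (l1ball I R) e"
    unfolding e_def l1norm_def by (intro continuous_intros)
  moreover have "l1ball I R \<noteq> {}"
    using R by (auto simp: l1ball_def l1norm_def intro!: exI[of _ "\<lambda>_. 0"])
  ultimately obtain x0 where x0: "\<forall>x\<in>l1ball I R. e x0 \<le> e x"
    using continuous_attains_inf[OF compact_l1ball[OF I]] by blast
  have "e x0 \<noteq> 0" using y by (auto simp: e_def l1norm_eq_0_iff[OF J])
  then have "e x0 > 0" by (simp add: e_def less_le)
  have "min 1 (e x0) \<le> e x" for x
  proof (cases "l1norm I x \<le> R")
    case True
    \<comment> \<open>The ball requires zeros outside \<open>I\<close>; truncation changes neither
      the norm nor the image.\<close>
    define x' where "x' i = (if i \<in> I then x i else 0)" for i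
    have "l1norm I x' = l1norm I x" by (rule l1norm_cong) (simp add: x'_def)
    then have "x' \<in> l1ball I R" using True by (auto simp: l1ball_def x'_def)
    moreover have "quadratic_map I c x' = quadratic_map I c x"
      by (intro ext bilinear_map_cong) (auto simp: x'_def)
    ultimately show ?thesis using x0 by (fastforce simp: e_def)
  next
    case False
    have "R * 1 \<le> l1norm I x * l1norm I x" using False R by (intro mult_mono) auto
    then have "\<mu> * R \<le> \<mu> * (l1norm I x)\<^sup>2" using \<mu>(1) by (simp add: power2_eq_square)
    then have "l1norm J y + 1 \<le> l1norm J (quadratic_map I c x)" using R \<mu>(2)[of x] by linarith
    moreover have "l1norm J (quadratic_map I c x) \<le> e x + l1norm J y"
      using l1norm_triangle[of J "\<lambda>j. quadratic_map I c x j - y j" y] by (simp add: e_def)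
    ultimately show ?thesis by linarith
  qed
  then show ?thesis using \<open>e x0 > 0\<close> by (intro exI[of _ "min 1 (e x0)"]) (auto simp: e_def)
qed

lemma quadratic_map_derivative_line:
  fixes c :: "'j \<Rightarrow> 'i \<Rightarrow> 'i \<Rightarrow> real"
  shows "((\<lambda>s. quadratic_map I c (\<lambda>i. x i + s * v i) j) has_real_derivative
    (bilinear_map I c x v j + bilinear_map I c v x j)) (at 0)"
proof -
  have "quadratic_map I c (\<lambda>i. x i + s * v i) j = quadratic_map I c x j +
      s * (bilinear_map I c x v j + bilinear_map I c v x j) + s\<^sup>2 * quadratic_map I c v j" for s
    by (simp add: quadratic_map_add bilinear_map_scale_left bilinear_map_scale_right
        power2_eq_square algebra_simps)
  then show ?thesis by (auto intro!: derivative_eq_intros)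
qed

text \<open>
  With \<open>L\<close> a right inverse of the derivative at \<open>q\<close>, solving \<open>\<Phi> (q + L w) = y\<close> amounts to finding a fixed
  point of a contraction \<open>T\<close>, obtained by minimizing the displacement on a compact ball.
\<close>

lemma quadratic_map_submersion_open:
  fixes c :: "'j \<Rightarrow> 'i \<Rightarrow> 'i \<Rightarrow> real"
  assumes I: "finite I" and J: "finite J"
    and surj: "\<And>y. \<exists>v. \<forall>j\<in>J. bilinear_map I c q v j + bilinear_map I c v q j = y j"
  shows "\<exists>\<delta>>0. \<forall>y. l1norm J (\<lambda>j. y j - quadratic_map I c q j) < \<delta> \<longrightarrow>
    (\<exists>x. \<forall>j\<in>J. quadratic_map I c x j = y j)"
proof -
  \<comment> \<open>\<open>P k v\<close> says that the derivative at \<open>q\<close> sends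
    \<open>v\<close> to the k-th unit vector; such preimages are the columns of the right inverse
    \<open>L\<close>.\<close>
  define P where "P k v \<longleftrightarrow>
      (\<forall>j\<in>J. bilinear_map I c q v j + bilinear_map I c v q j = (if j = k then 1 else 0))" for k v
  have "\<exists>v. P k v" for k unfolding P_def by (rule surj)
  then obtain V where "\<And>k. P k (V k)" by metis
  then have V: "bilinear_map I c q (V k) j + bilinear_map I c (V k) q j = (if j = k then 1 else 0)"
    if "j \<in> J" for k j
    using that unfolding P_def by blast
  define L where "L w i = (\<Sum>k\<in>J. w k * V k i)" for w i
  have DL: "bilinear_map I c q (L w) j + bilinear_map I c (L w) q j = w j" if j: "j \<in> J" for w j
  proof -
    have "bilinear_map I c q (L w) j + bilinear_map I c (L w) q j =
        (\<Sum>k\<in>J. w k * (bilinear_map I c q (V k) j + bilinear_map I c (V k) q j))"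
    proof -
      have "bilinear_map I c q (\<lambda>i. \<Sum>k\<in>K. w k * V k i) j + bilinear_map I c (\<lambda>i. \<Sum>k\<in>K. w k * V k i) q j =
        (\<Sum>k\<in>K. w k * (bilinear_map I c q (V k) j + bilinear_map I c (V k) q j))" if "finite K" for K
        using that
      proof (induction K rule: finite_induct)
        case (insert k K)
        then show ?case
          by (simp add: bilinear_map_add_left bilinear_map_add_right bilinear_map_scale_left
              bilinear_map_scale_right algebra_simps)
      qed (simp add: bilinear_map_def)
      then show ?thesis using J by (simp add: L_def[abs_def])
    qed
    also have "\<dots> = (\<Sum>k\<in>J. if j = k then w k else 0)" by (rule sum.cong) (auto simp: V[OF j])
    finally show ?thesis using j J by simp
  qed
  define A where "A = (\<Sum>k\<in>J. l1norm I (V k))"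
  have "A \<ge> 0" by (auto simp: A_def intro: sum_nonneg)
  have L_bound: "l1norm I (L w) \<le> A * l1norm J w" for w
  proof -
    have "l1norm I (L w) \<le> (\<Sum>k\<in>J. \<bar>w k\<bar> * l1norm I (V k))"
      unfolding L_def l1norm_scale[symmetric] by (rule l1norm_sum[OF J])
    also have "\<dots> \<le> (\<Sum>k\<in>J. l1norm J w * l1norm I (V k))"
      by (intro sum_mono mult_right_mono abs_le_l1norm[OF J]) auto
    finally show ?thesis by (simp add: A_def sum_distrib_left mult.commute)
  qed
  have L_diff: "L w = (\<lambda>i. L w' i + L (\<lambda>j. w j - w' j) i)" for w w'
    by (simp add: L_def[abs_def] left_diff_distrib flip: sum.distrib)
  obtain C where C: "C > 0" "\<And>x y. l1norm J (bilinear_map I c x y) \<le> C * (l1norm I x * l1norm I y)"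
    using bilinear_map_bound[OF I J, of c] by blast
  define \<kappa> where "\<kappa> = C * (A * A) + 1"
  have \<kappa>: "\<kappa> > 0" using C(1) \<open>A \<ge> 0\<close> by (simp add: \<kappa>_def add_nonneg_pos)
  have BL: "l1norm J (bilinear_map I c (L w) (L w')) \<le> \<kappa> * (l1norm J w * l1norm J w')" for w w'
  proof -
    have "l1norm J (bilinear_map I c (L w) (L w')) \<le> C * ((A * l1norm J w) * (A * l1norm J w'))"
      using C(1) \<open>A \<ge> 0\<close> by (intro order_trans[OF C(2)] mult_left_mono mult_mono L_bound) auto
    also have "\<dots> = C * (A * A) * (l1norm J w * l1norm J w')" by simp
    also have "\<dots> \<le> \<kappa> * (l1norm J w * l1norm J w')"
      unfolding \<kappa>_def by (intro mult_right_mono) auto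
    finally show ?thesis .
  qed
  \<comment> \<open>On the ball of radius \<open>R\<close> the map w \<mapsto> \<Phi>(L w) has
    Lipschitz constant 2 \<kappa> R = 1/2 and norm at most \<kappa> R R = R/4. Together with a
    displacement below R/2 this keeps \<open>T\<close> inside the ball.\<close>
  define R where "R = 1 / (4 * \<kappa>)"
  have R: "R > 0" "\<kappa> * R = 1 / 4" using \<kappa> by (auto simp: R_def)
  have lip: "l1norm J (\<lambda>j. quadratic_map I c (L w) j - quadratic_map I c (L w') j) \<le> l1norm J (\<lambda>j. w j - w' j) / 2"
    if w: "l1norm J w \<le> R" "l1norm J w' \<le> R" for w w'
  proof -
    define d where "d j = w j - w' j" for j
    have "quadratic_map I c (L w) j - quadratic_map I c (L w') j =
        bilinear_map I c (L w) (L d) j + bilinear_map I c (L d) (L w') j" for j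
    proof -
      have "quadratic_map I c (L w) j = bilinear_map I c (L w) (\<lambda>i. L w' i + L d i) j"
        using L_diff[of w w'] by (simp add: d_def[abs_def])
      also have "\<dots> = bilinear_map I c (\<lambda>i. L w' i + L d i) (L w') j + bilinear_map I c (L w) (L d) j"
        using L_diff[of w w'] by (simp add: d_def[abs_def] bilinear_map_add_right)
      finally show ?thesis by (simp add: bilinear_map_add_left)
    qed
    then have "l1norm J (\<lambda>j. quadratic_map I c (L w) j - quadratic_map I c (L w') j) \<le>
        l1norm J (bilinear_map I c (L w) (L d)) + l1norm J (bilinear_map I c (L d) (L w'))"
      using l1norm_triangle by simp
    also have "\<dots> \<le> \<kappa> * (R * l1norm J d) + \<kappa> * (l1norm J d * R)"
      using w \<kappa> R by (intro add_mono order_trans[OF BL] mult_left_mono mult_mono) auto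
    also have "\<dots> = (\<kappa> * R) * l1norm J d * 2" by simp
    finally show ?thesis using R(2) by (simp add: d_def[abs_def])
  qed
  have "\<exists>x. \<forall>j\<in>J. quadratic_map I c x j = y j"
    if y: "l1norm J (\<lambda>j. y j - quadratic_map I c q j) < R / 2" for y
  proof -
    define u where "u j = y j - quadratic_map I c q j" for j
    \<comment> \<open>By \<open>DL\<close>, \<Phi>(q + L w) = \<Phi>(q) + w + \<Phi>(L w) on
      \<open>J\<close>, so \<Phi>(q + L w) = y means w = u - \<Phi>(L w). The value 0 outside
      \<open>J\<close> is required by \<open>l1ball\<close>.\<close>
    define T where "T w j = (if j \<in> J then u j - quadratic_map I c (L w) j else 0)" for w j
    define e where "e w = l1norm J (\<lambda>j. w j - T w j)" for w
    have T_in: "T w \<in> l1ball J R" if w: "w \<in> l1ball J R" for w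
    proof -
      have "l1norm J (T w) = l1norm J (\<lambda>j. u j + (- 1) * quadratic_map I c (L w) j)"
        by (rule l1norm_cong) (simp add: T_def)
      also have "\<dots> \<le> l1norm J u + l1norm J (\<lambda>j. (- 1) * quadratic_map I c (L w) j)"
        by (rule l1norm_triangle)
      also have "l1norm J (\<lambda>j. (- 1) * quadratic_map I c (L w) j) = l1norm J (quadratic_map I c (L w))"
        by (simp add: l1norm_def)
      also have "\<dots> \<le> \<kappa> * (R * R)"
        using w \<kappa> R by (intro order_trans[OF BL] mult_left_mono mult_mono) (auto simp: l1ball_def)
      also have "\<kappa> * (R * R) = R / 4" using R(2) by simp
      finally have "l1norm J (T w) \<le> R" using y R by (simp add: u_def[abs_def])
      then show ?thesis by (simp add: l1ball_def T_def)
    qed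
    have "continuous_on (l1ball J R) (\<lambda>w. T w j)" for j
      unfolding T_def L_def by (cases "j \<in> J") (auto intro!: continuous_intros)
    then have "continuous_on (l1ball J R) e"
      unfolding e_def l1norm_def by (intro continuous_intros)
    moreover have "l1ball J R \<noteq> {}"
      using R by (auto simp: l1ball_def l1norm_def intro!: exI[of _ "\<lambda>_. 0"])
    ultimately obtain w where w: "w \<in> l1ball J R" "\<forall>w'\<in>l1ball J R. e w \<le> e w'"
      using continuous_attains_inf[OF compact_l1ball[OF J]] by blast
    \<comment> \<open>\<open>T\<close> at least halves the displacement, so a minimizer has
      displacement 0.\<close>
    have "e (T w) = l1norm J (\<lambda>j. quadratic_map I c (L (T w)) j - quadratic_map I c (L w) j)"
      unfolding e_def by (rule l1norm_cong) (simp add: T_def[of w] T_def[of "T w"])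
    also have "\<dots> \<le> l1norm J (\<lambda>j. T w j - w j) / 2"
      using w(1) T_in by (intro lip) (auto simp: l1ball_def)
    also have "\<dots> = e w / 2" by (simp add: e_def l1norm_minus_commute)
    finally have "e (T w) \<le> e w / 2" .
    moreover have "e w \<le> e (T w)" using w T_in by blast
    moreover have "0 \<le> e w" by (simp add: e_def)
    ultimately have "e w = 0" by linarith
    then have "w j = u j - quadratic_map I c (L w) j" if "j \<in> J" for j
      using that by (auto simp: e_def l1norm_eq_0_iff[OF J] T_def)
    then have "quadratic_map I c (\<lambda>i. q i + L w i) j = y j" if "j \<in> J" for j
      using that DL[OF that, of w] by (simp add: quadratic_map_add u_def)
    then show ?thesis by blast
  qed
  then show ?thesis using R by (intro exI[of _ "R / 2"]) auto
qed

text \<open>The line from \<open>x\<close> to a point \<open>w\<close> with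
  \<open>g w \<noteq> 0\<close> meets the zero set of \<open>g\<close> finitely often. So there are
  points arbitrarily close to \<open>x\<close> where the map is a submersion, and their images are
  interior.\<close>

lemma quadratic_image_interior_dense:
  fixes c :: "'j \<Rightarrow> 'i \<Rightarrow> 'i \<Rightarrow> real"
  assumes I: "finite I" and J: "finite J"
    and indep: "alg_independent J (\<lambda>j x. quadratic_map I c x j)" and "\<epsilon> > 0"
  shows "\<exists>q. l1norm J (\<lambda>j. quadratic_map I c q j - quadratic_map I c x j) < \<epsilon> \<and>
    (\<exists>\<delta>>0. \<forall>y. l1norm J (\<lambda>j. y j - quadratic_map I c q j) < \<delta> \<longrightarrow>
      (\<exists>x. \<forall>j\<in>J. quadratic_map I c x j = y j))"
proof -
  obtain k g where g: "polyfun I k g" "\<exists>x. g x \<noteq> 0"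
    "\<And>x f' y. g x \<noteq> 0 \<Longrightarrow>
      (\<And>j v. j \<in> J \<Longrightarrow> ((\<lambda>s. quadratic_map I c (\<lambda>i. x i + s * v i) j) has_real_derivative
        (\<Sum>i\<in>I. f' j i * v i)) (at 0)) \<Longrightarrow>
      \<exists>v. \<forall>j\<in>J. (\<Sum>i\<in>I. f' j i * v i) = y j"
    using alg_independent_imp_generic_submersion[OF I J indep polyfun_quadratic_map] by blast
  from g(2) obtain w where w: "g w \<noteq> 0" by blast
  define \<gamma> where "\<gamma> s i = x i + s * (w i - x i)" for s i
  have "finite {s. g (\<gamma> s) = 0}"
    unfolding \<gamma>_def using w by (intro polyfun_line_finite_zeros[OF g(1), of x 1]) simp
  define h where "h s = l1norm J (\<lambda>j. quadratic_map I c (\<gamma> s) j - quadratic_map I c x j)" for s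
  have "continuous_on UNIV h"
    unfolding h_def l1norm_def \<gamma>_def by (intro continuous_intros)
  then have "h \<midarrow>0\<rightarrow> h 0" by (simp add: continuous_on_def)
  moreover have "\<gamma> 0 = x" by (auto simp: \<gamma>_def)
  then have "h 0 = 0" by (simp add: h_def l1norm_def)
  ultimately have "eventually (\<lambda>s. h s < \<epsilon>) (at 0)"
    using \<open>\<epsilon> > 0\<close> order_tendstoD(2) by fastforce
  then obtain d where d: "d > 0" "\<And>s. s \<noteq> 0 \<Longrightarrow> \<bar>s\<bar> < d \<Longrightarrow> h s < \<epsilon>"
    by (auto simp: eventually_at dist_real_def)
  have "\<not> {0<..<d} \<subseteq> {s. g (\<gamma> s) = 0}"
    using \<open>finite {s. g (\<gamma> s) = 0}\<close> infinite_Ioo[OF d(1)] finite_subset by blast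
  then obtain s where "s \<in> {0<..<d}" "s \<notin> {s. g (\<gamma> s) = 0}" by blast
  then have s: "0 < s" "s < d" "g (\<gamma> s) \<noteq> 0" by auto
  \<comment> \<open>The Jacobian matrix at \<open>\<gamma> s\<close>; each partial derivative
    collects the contributions of both slots.\<close>
  define f' where "f' j i = (\<Sum>b\<in>I. c j i b * \<gamma> s b) + (\<Sum>a\<in>I. c j a i * \<gamma> s a)" for j i
  have f': "(\<Sum>i\<in>I. f' j i * v i) = bilinear_map I c (\<gamma> s) v j + bilinear_map I c v (\<gamma> s) j" for j v
  proof -
    have "(\<Sum>i\<in>I. (\<Sum>a\<in>I. c j a i * \<gamma> s a) * v i) = bilinear_map I c (\<gamma> s) v j"
      unfolding bilinear_map_def sum_distrib_right by (subst sum.swap) (simp add: mult.assoc)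
    moreover have "(\<Sum>i\<in>I. (\<Sum>b\<in>I. c j i b * \<gamma> s b) * v i) = bilinear_map I c v (\<gamma> s) j"
      unfolding bilinear_map_def sum_distrib_right by (simp add: mult_ac)
    ultimately show ?thesis by (simp add: f'_def distrib_right sum.distrib)
  qed
  have "\<exists>v. \<forall>j\<in>J. bilinear_map I c (\<gamma> s) v j + bilinear_map I c v (\<gamma> s) j = y j" for y
    using g(3)[OF s(3), of f' y, unfolded f', OF quadratic_map_derivative_line] .
  from quadratic_map_submersion_open[OF I J this] show ?thesis
    using d(2)[of s] s(1,2) unfolding h_def by (intro exI[of _ "\<gamma> s"] conjI) simp_all
qed

section \<open>Forms and their coefficient vectors\<close>

definition monomials :: "nat \<Rightarrow> nat \<Rightarrow> (nat \<Rightarrow>\<^sub>0 nat) set" where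
  "monomials n e = {m. Poly_Mapping.keys m \<subseteq> {..<n} \<and> (\<Sum>i<n. Poly_Mapping.lookup m i) = e}"

lemma finite_monomials [simp]: "finite (monomials n e)"
proof -
  define restr where "restr m = restrict (Poly_Mapping.lookup m) {..<n}" for m :: "nat \<Rightarrow>\<^sub>0 nat"
  have "inj_on restr (monomials n e)"
  proof (rule inj_onI)
    fix m m' assume m: "m \<in> monomials n e" "m' \<in> monomials n e" "restr m = restr m'"
    have "Poly_Mapping.lookup m i = Poly_Mapping.lookup m' i" for i
    proof (cases "i < n")
      case True
      then show ?thesis using fun_cong[OF m(3), of i] by (simp add: restr_def)
    next
      case False
      then have "i \<notin> Poly_Mapping.keys m" "i \<notin> Poly_Mapping.keys m'"
        using m(1,2) by (auto simp: monomials_def)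
      then show ?thesis by (simp add: in_keys_iff)
    qed
    then show "m = m'" by (rule poly_mapping_eqI)
  qed
  moreover have "restr ` monomials n e \<subseteq> PiE {..<n} (\<lambda>_. {..e})"
  proof
    fix y assume "y \<in> restr ` monomials n e"
    then obtain m where m: "y = restr m" "(\<Sum>i<n. Poly_Mapping.lookup m i) = e"
      by (auto simp: monomials_def)
    have "Poly_Mapping.lookup m i \<le> e" if "i < n" for i
      unfolding m(2)[symmetric] using that by (intro member_le_sum) auto
    then show "y \<in> PiE {..<n} (\<lambda>_. {..e})" by (auto simp: m(1) restr_def)
  qed
  ultimately show ?thesis
    using finite_PiE[of "{..<n}" "\<lambda>_. {..e}"] finite_subset finite_imageD by blast
qed

lemma forms_eq: "forms n e = {f. Poly_Mapping.keys f \<subseteq> monomials n e}"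
  by (auto simp: forms_def monomials_def)

lemma lookup_form_outside: "f \<in> forms n e \<Longrightarrow> m \<notin> monomials n e \<Longrightarrow> Poly_Mapping.lookup f m = 0"
  by (auto simp: forms_eq in_keys_iff)

lemma monomials_add:
  assumes "a \<in> monomials n k" "b \<in> monomials n l"
  shows "a + b \<in> monomials n (k + l)"
  using assms keys_add[of a b] by (auto simp: monomials_def lookup_add sum.distrib)

text \<open>Polarization needs every monomial of degree 2d as a product of two of degree d. The
  proof moves one variable at a time from the second factor to the first.\<close>

lemma monomials_split:
  assumes "m \<in> monomials n (k + l)"
  shows "\<exists>a\<in>monomials n k. \<exists>b\<in>monomials n l. m = a + b"
  using assms
proof (induction k arbitrary: l)
  case 0
  then show ?case
    by (intro bexI[of _ 0] bexI[of _ m]) (auto simp: monomials_def)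
next
  case (Suc k)
  then obtain a b where ab: "a \<in> monomials n k" "b \<in> monomials n (Suc l)" "m = a + b"
    using Suc.IH[of "Suc l"] by (metis add_Suc_shift)
  then have "(\<Sum>i<n. Poly_Mapping.lookup b i) \<noteq> 0" by (auto simp: monomials_def)
  then obtain i where i: "i < n" "Poly_Mapping.lookup b i > 0" by (auto intro: sum.neutral)
  define s :: "nat \<Rightarrow>\<^sub>0 nat" where "s = Poly_Mapping.single i 1"
  have s: "s \<in> monomials n 1"
    using i(1) by (auto simp: monomials_def s_def lookup_single when_def sum.delta)
  have b: "b = s + (b - s)"
    using i(2) by (intro poly_mapping_eqI) (auto simp: s_def lookup_add lookup_minus lookup_single when_def)
  have "(\<Sum>i<n. Poly_Mapping.lookup b i) = 1 + (\<Sum>i<n. Poly_Mapping.lookup (b - s) i)"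
    using s by (subst b) (simp add: lookup_add sum.distrib monomials_def)
  moreover have "Poly_Mapping.keys (b - s) \<subseteq> Poly_Mapping.keys b"
    by (auto simp: in_keys_iff lookup_minus)
  ultimately have "b - s \<in> monomials n l" using ab(2) by (auto simp: monomials_def)
  moreover have "a + s \<in> monomials n (Suc k)" using monomials_add[OF ab(1) s] by simp
  moreover have "m = (a + s) + (b - s)" using ab(3) b by (metis add.assoc)
  ultimately show ?case by blast
qed

text \<open>The inverse of \<open>Poly_Mapping.lookup\<close> on forms. Values off
  \<open>monomials n e\<close> are discarded, so any coefficient function may be supplied.\<close>

definition form_of :: "nat \<Rightarrow> nat \<Rightarrow> ((nat \<Rightarrow>\<^sub>0 nat) \<Rightarrow> 'a) \<Rightarrow> 'a::comm_monoid_add mpoly" where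
  "form_of n e x = (\<Sum>m\<in>monomials n e. Poly_Mapping.single m (x m))"

lemma lookup_form_of:
  "Poly_Mapping.lookup (form_of n e x) m = (if m \<in> monomials n e then x m else 0)"
  unfolding form_of_def lookup_sum lookup_single when_def by (simp add: sum.delta)

lemma form_of_in_forms [simp]: "form_of n e x \<in> forms n e"
  by (auto simp: forms_eq in_keys_iff lookup_form_of split: if_splits)

lemma form_of_lookup: "f \<in> forms n e \<Longrightarrow> form_of n e (Poly_Mapping.lookup f) = f"
  by (intro poly_mapping_eqI) (auto simp: lookup_form_of lookup_form_outside)

text \<open>The structure constants of polynomial multiplication: with them,
  \<open>quadratic_map\<close> computes the coefficients of a square.\<close>

definition conv_coeff :: "(nat \<Rightarrow>\<^sub>0 nat) \<Rightarrow> (nat \<Rightarrow>\<^sub>0 nat) \<Rightarrow> (nat \<Rightarrow>\<^sub>0 nat) \<Rightarrow> 'a::field" where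
  "conv_coeff m a b = (if a + b = m then 1 else 0)"

lemma lookup_form_square:
  fixes p :: "'a::field mpoly"
  assumes "p \<in> forms n d"
  shows "Poly_Mapping.lookup (p ^ 2) m = quadratic_map (monomials n d) conv_coeff (Poly_Mapping.lookup p) m"
proof -
  have "p ^ 2 = form_of n d (Poly_Mapping.lookup p) * form_of n d (Poly_Mapping.lookup p)"
    by (simp add: form_of_lookup[OF assms] power2_eq_square)
  also have "Poly_Mapping.lookup \<dots> m = quadratic_map (monomials n d) conv_coeff (Poly_Mapping.lookup p) m"
    unfolding form_of_def sum_product mult_single lookup_sum lookup_single bilinear_map_def
    by (intro sum.cong) (auto simp: conv_coeff_def)
  finally show ?thesis .
qed

lemma conv_outside:
  fixes x y :: "(nat \<Rightarrow>\<^sub>0 nat) \<Rightarrow> 'a::field"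
  assumes "m \<notin> monomials n (2 * d)"
  shows "bilinear_map (monomials n d) conv_coeff x y m = 0"
  unfolding bilinear_map_def
proof (intro sum.neutral ballI)
  fix a b assume "a \<in> monomials n d" "b \<in> monomials n d"
  then have "a + b \<noteq> m" using assms monomials_add[of a n d b d] by (auto simp: mult_2)
  then show "conv_coeff m a b * (x a * y b) = 0" by (simp add: conv_coeff_def)
qed

lemma sums_of_squares_iff:
  fixes f :: "'a::field mpoly"
  shows "f \<in> sums_of_squares n d r \<longleftrightarrow> f \<in> forms n (2 * d) \<and>
    (\<exists>x. \<forall>m\<in>monomials n (2 * d). Poly_Mapping.lookup f m =
      (\<Sum>i<r. quadratic_map (monomials n d) conv_coeff (x i) m))"
proof
  assume "f \<in> sums_of_squares n d r"
  then obtain p where p: "f = (\<Sum>i<r. p i ^ 2)" "\<And>i. i < r \<Longrightarrow> p i \<in> forms n d"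
    by (auto simp: sums_of_squares_def)
  have eq: "Poly_Mapping.lookup f m =
      (\<Sum>i<r. quadratic_map (monomials n d) conv_coeff (Poly_Mapping.lookup (p i)) m)" for m
    unfolding p(1) lookup_sum by (intro sum.cong) (auto simp: lookup_form_square p(2))
  have "f \<in> forms n (2 * d)"
  proof -
    have "Poly_Mapping.lookup f m = 0" if "m \<notin> monomials n (2 * d)" for m
      unfolding eq by (intro sum.neutral ballI conv_outside[OF that])
    then show ?thesis by (auto simp: forms_eq in_keys_iff)
  qed
  then show "f \<in> forms n (2 * d) \<and> (\<exists>x. \<forall>m\<in>monomials n (2 * d). Poly_Mapping.lookup f m =
      (\<Sum>i<r. quadratic_map (monomials n d) conv_coeff (x i) m))"
    using eq by (intro conjI exI[of _ "\<lambda>i. Poly_Mapping.lookup (p i)"]) auto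
next
  assume "f \<in> forms n (2 * d) \<and> (\<exists>x. \<forall>m\<in>monomials n (2 * d). Poly_Mapping.lookup f m =
      (\<Sum>i<r. quadratic_map (monomials n d) conv_coeff (x i) m))"
  then obtain x where f: "f \<in> forms n (2 * d)" and x: "\<forall>m\<in>monomials n (2 * d). Poly_Mapping.lookup f m =
      (\<Sum>i<r. quadratic_map (monomials n d) conv_coeff (x i) m)" by blast
  define p where "p i = form_of n d (x i)" for i
  have "f = (\<Sum>i<r. p i ^ 2)"
  proof (rule poly_mapping_eqI)
    fix m
    have "Poly_Mapping.lookup (\<Sum>i<r. p i ^ 2) m =
        (\<Sum>i<r. quadratic_map (monomials n d) conv_coeff (Poly_Mapping.lookup (p i)) m)"
      unfolding lookup_sum by (intro sum.cong) (auto simp: lookup_form_square p_def)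
    also have "\<dots> = (\<Sum>i<r. quadratic_map (monomials n d) conv_coeff (x i) m)"
      by (intro sum.cong bilinear_map_cong) (auto simp: p_def lookup_form_of)
    finally have "Poly_Mapping.lookup (\<Sum>i<r. p i ^ 2) m =
        (\<Sum>i<r. quadratic_map (monomials n d) conv_coeff (x i) m)" .
    then show "Poly_Mapping.lookup f m = Poly_Mapping.lookup (\<Sum>i<r. p i ^ 2) m"
      using x lookup_form_outside[OF f]
      by (cases "m \<in> monomials n (2 * d)") (auto simp: conv_outside)
  qed
  then show "f \<in> sums_of_squares n d r"
    unfolding sums_of_squares_def by (auto simp: p_def)
qed

text \<open>Frees the squares from the index set \<open>{..<r}\<close>: polarization indexes them by
  pairs, and Caratheodory's argument deletes one index.\<close>

lemma sums_of_squares_indexed: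
  fixes f :: "'a::field mpoly"
  assumes "finite A" "f \<in> forms n (2 * d)"
    and eq: "\<And>m. m \<in> monomials n (2 * d) \<Longrightarrow>
      Poly_Mapping.lookup f m = (\<Sum>i\<in>A. quadratic_map (monomials n d) conv_coeff (x i) m)"
  shows "f \<in> sums_of_squares n d (card A)"
proof -
  obtain h where h: "bij_betw h {..<card A} A"
    using ex_bij_betw_nat_finite[OF assms(1)] by (auto simp: atLeast0LessThan)
  have "(\<Sum>i\<in>A. quadratic_map (monomials n d) conv_coeff (x i) m) =
      (\<Sum>i<card A. quadratic_map (monomials n d) conv_coeff (x (h i)) m)" for m
    by (rule sum.reindex_bij_betw[OF h, symmetric])
  then show ?thesis
    unfolding sums_of_squares_iff using assms(2) eq by (intro conjI exI[of _ "\<lambda>i. x (h i)"]) auto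
qed

section \<open>How the sets of sums of squares depend on the number of squares\<close>

lemma sums_of_squares_mono:
  assumes "r \<le> s"
  shows "sums_of_squares n d r \<subseteq> (sums_of_squares n d s :: 'a::comm_ring_1 mpoly set)"
proof
  fix f :: "'a mpoly" assume "f \<in> sums_of_squares n d r"
  then obtain p where p: "f = (\<Sum>i<r. p i ^ 2)" "\<And>i. i < r \<Longrightarrow> p i \<in> forms n d"
    by (auto simp: sums_of_squares_def)
  define q where "q i = (if i < r then p i else 0)" for i
  have "(\<Sum>i<s. q i ^ 2) = (\<Sum>i<r. q i ^ 2)"
    using assms by (intro sum.mono_neutral_right) (auto simp: q_def)
  also have "\<dots> = f" unfolding p(1) by (intro sum.cong) (auto simp: q_def)
  finally have "f = (\<Sum>i<s. q i ^ 2)" by simp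
  moreover have "q i \<in> forms n d" for i using p(2) by (auto simp: q_def forms_def)
  ultimately show "f \<in> sums_of_squares n d s" by (auto simp: sums_of_squares_def)
qed

text \<open>
  Polarization: \<open>4 x\<^sup>a x\<^sup>b = (x\<^sup>a + x\<^sup>b)\<^sup>2 + (\<i> (x\<^sup>a - x\<^sup>b))\<^sup>2\<close>.
\<close>

lemma complex_forms_are_sums_of_squares:
  "(sums_of_squares n d (2 * card (monomials n (2 * d))) :: complex mpoly set) = forms n (2 * d)"
proof
  show "(sums_of_squares n d (2 * card (monomials n (2 * d))) :: complex mpoly set) \<subseteq> forms n (2 * d)"
    by (auto simp: sums_of_squares_iff)
  show "forms n (2 * d) \<subseteq> (sums_of_squares n d (2 * card (monomials n (2 * d))) :: complex mpoly set)"
  proof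
    fix f :: "complex mpoly" assume f: "f \<in> forms n (2 * d)"
    let ?M = "monomials n (2 * d)" and ?B = "bilinear_map (monomials n d) conv_coeff"
    have "\<forall>m\<in>?M. \<exists>ab. fst ab \<in> monomials n d \<and> snd ab \<in> monomials n d \<and> m = fst ab + snd ab"
      using monomials_split[of _ n d d] by (fastforce simp: mult_2)
    then obtain h where h: "\<And>m. m \<in> ?M \<Longrightarrow>
        fst (h m) \<in> monomials n d \<and> snd (h m) \<in> monomials n d \<and> m = fst (h m) + snd (h m)"
      by metis
    define e where "e a b = (if a = b then 1 else 0 :: complex)" for a b :: "nat \<Rightarrow>\<^sub>0 nat"
    have Be: "?B (e a) (e b) m = (if a + b = m then 1 else 0)"
      if "a \<in> monomials n d" "b \<in> monomials n d" for a b m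
    proof -
      have "?B (e a) (e b) m = (\<Sum>a'\<in>monomials n d. \<Sum>b'\<in>monomials n d.
          if b' = b then if a' = a then conv_coeff m a b else 0 else 0)"
        unfolding bilinear_map_def by (intro sum.cong) (auto simp: e_def)
      also have "\<dots> = conv_coeff m a b" using that by (simp add: sum.delta)
      finally show ?thesis by (simp add: conv_coeff_def)
    qed
    \<comment> \<open>The half cancels the factor 4 of the polarization identity; the Boolean in
      \<open>x\<close> selects one of the two squares for each monomial.\<close>
    define w where "w m = csqrt (Poly_Mapping.lookup f m) / 2" for m
    have w: "(w m)\<^sup>2 = Poly_Mapping.lookup f m / 4" for m by (simp add: w_def power_divide)
    define x where "x k = (case k of (m, \<sigma>) \<Rightarrow>
        if \<sigma> then (\<lambda>c. w m * (e (fst (h m)) c + e (snd (h m)) c))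
        else (\<lambda>c. (\<i> * w m) * (e (fst (h m)) c + (- 1) * e (snd (h m)) c)))" for k
    have pair: "?B (x (m, True)) (x (m, True)) m' + ?B (x (m, False)) (x (m, False)) m' =
        (if m = m' then Poly_Mapping.lookup f m else 0)" if m: "m \<in> ?M" for m m'
    proof -
      have ab: "?B (e (fst (h m))) (e (snd (h m))) m' = (if m = m' then 1 else 0)"
          "?B (e (snd (h m))) (e (fst (h m))) m' = (if m = m' then 1 else 0)"
        using h[OF m] Be by (auto simp: add.commute)
      have "?B (x (m, True)) (x (m, True)) m' + ?B (x (m, False)) (x (m, False)) m' =
        4 * (w m)\<^sup>2 * (if m = m' then 1 else 0)"
        unfolding x_def prod.case if_True if_False quadratic_map_scale quadratic_map_add
          bilinear_map_scale_left bilinear_map_scale_right ab power_mult_distrib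
        by (simp add: algebra_simps)
      then show ?thesis by (simp add: w)
    qed
    have "f \<in> sums_of_squares n d (card (?M \<times> (UNIV :: bool set)))"
    proof (rule sums_of_squares_indexed[OF _ f])
      fix m' assume m': "m' \<in> ?M"
      have "(\<Sum>k\<in>?M \<times> UNIV. ?B (x k) (x k) m') =
          (\<Sum>m\<in>?M. \<Sum>\<sigma>\<in>UNIV. ?B (x (m, \<sigma>)) (x (m, \<sigma>)) m')"
        by (simp add: sum.cartesian_product)
      also have "\<dots> = (\<Sum>m\<in>?M. if m = m' then Poly_Mapping.lookup f m else 0)"
        by (intro sum.cong refl) (subst pair[symmetric], auto simp: UNIV_bool)
      also have "\<dots> = Poly_Mapping.lookup f m'" using m' by simp
      finally show "Poly_Mapping.lookup f m' = (\<Sum>k\<in>?M \<times> UNIV. ?B (x k) (x k) m')" by simp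
    qed simp
    then show "f \<in> sums_of_squares n d (2 * card ?M)" by (simp add: card_cartesian_product mult.commute)
  qed
qed

text \<open>With more squares than monomials of degree 2d, the squares are linearly dependent.
  Subtracting a suitable multiple of the dependence makes one weight 0 and keeps the others
  nonnegative; square roots of the weights are absorbed into the forms.\<close>

lemma sums_of_squares_caratheodory:
  "sums_of_squares n d r \<subseteq> (sums_of_squares n d (card (monomials n (2 * d))) :: real mpoly set)"
proof (induction r)
  case 0
  then show ?case by (intro sums_of_squares_mono) simp
next
  case (Suc r)
  let ?M = "monomials n (2 * d)" and ?Q = "\<lambda>x. bilinear_map (monomials n d) conv_coeff x x"
  show ?case
  proof (cases "Suc r \<le> card ?M")
    case True
    then show ?thesis by (rule sums_of_squares_mono)
  next
    case False
    show ?thesis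
    proof
      fix f :: "real mpoly" assume "f \<in> sums_of_squares n d (Suc r)"
      then obtain x where f: "f \<in> forms n (2 * d)"
          "\<And>m. m \<in> ?M \<Longrightarrow> Poly_Mapping.lookup f m = (\<Sum>i<Suc r. ?Q (x i) m)"
        unfolding sums_of_squares_iff by blast
      have "card ?M < card {..<Suc r}" using False by simp
      from underdetermined_system[OF _ _ this, of "\<lambda>m i. ?Q (x i) m"]
      obtain c0 where c0: "\<exists>i\<in>{..<Suc r}. c0 i \<noteq> 0" "\<forall>m\<in>?M. (\<Sum>i<Suc r. ?Q (x i) m * c0 i) = 0"
        by auto
      \<comment> \<open>Replacing the dependence by its negative if necessary gives it a positive
        coefficient.\<close>
      obtain c where c: "\<exists>i\<in>{..<Suc r}. c i > 0" "\<forall>m\<in>?M. (\<Sum>i<Suc r. ?Q (x i) m * c i) = 0"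
      proof (cases "\<exists>i\<in>{..<Suc r}. c0 i > 0")
        case True
        then show ?thesis using that c0(2) by blast
      next
        case False
        then have "\<exists>i\<in>{..<Suc r}. - c0 i > 0" using c0(1) by (metis neg_0_less_iff_less linorder_neqE)
        moreover have "\<forall>m\<in>?M. (\<Sum>i<Suc r. ?Q (x i) m * - c0 i) = 0"
          using c0(2) by (simp only: mult_minus_right sum_negf) simp
        ultimately show ?thesis by (rule that)
      qed
      \<comment> \<open>For the largest coefficient \<open>c k\<close>, which is positive, all
        weights 1 - c i / c k are nonnegative and the k-th is 0.\<close>
      have "Max (c ` {..<Suc r}) \<in> c ` {..<Suc r}" by (intro Max_in) auto
      then obtain k where k: "k < Suc r" "c k = Max (c ` {..<Suc r})" by auto
      have ck: "c i \<le> c k" if "i < Suc r" for i unfolding k(2) using that by (intro Max_ge) auto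
      then have "c k > 0" using c(1) by force
      define w where "w i = sqrt (1 - c i / c k)" for i
      have w2: "(w i)\<^sup>2 = 1 - c i / c k" if "i < Suc r" for i
        using ck[OF that] \<open>c k > 0\<close> by (simp add: w_def)
      have "Poly_Mapping.lookup f m = (\<Sum>i\<in>{..<Suc r} - {k}. ?Q (\<lambda>a. w i * x i a) m)"
        if m: "m \<in> ?M" for m
      proof -
        have "(\<Sum>i\<in>{..<Suc r} - {k}. ?Q (\<lambda>a. w i * x i a) m) = (\<Sum>i<Suc r. ?Q (\<lambda>a. w i * x i a) m)"
          using k(1) \<open>c k > 0\<close>
          by (intro sum.mono_neutral_left) (auto simp: w_def bilinear_map_scale_left)
        also have "\<dots> = (\<Sum>i<Suc r. ?Q (x i) m - ?Q (x i) m * c i / c k)"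
          by (intro sum.cong) (auto simp: quadratic_map_scale w2 algebra_simps)
        also have "\<dots> = (\<Sum>i<Suc r. ?Q (x i) m) - (\<Sum>i<Suc r. ?Q (x i) m * c i) / c k"
          by (simp only: sum_subtractf sum_divide_distrib)
        also have "\<dots> = Poly_Mapping.lookup f m" using c(2) m f(2)[OF m] by simp
        finally show ?thesis by simp
      qed
      then have "f \<in> sums_of_squares n d (card ({..<Suc r} - {k}))"
        using f(1) by (intro sums_of_squares_indexed) auto
      moreover have "card ({..<Suc r} - {k}) = r" using k(1) by simp
      ultimately show "f \<in> sums_of_squares n d (card ?M)" using Suc.IH by auto
    qed
  qed
qed

text \<open>Compress the first \<open>s\<close> squares to \<open>r\<close> by induction, restore
  the last one, and compress \<open>Suc r\<close> squares to \<open>r\<close> by assumption.\<close>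

lemma sums_of_squares_stationary:
  assumes "sums_of_squares n d (Suc r) \<subseteq> (sums_of_squares n d r :: 'a::comm_ring_1 mpoly set)"
  shows "sums_of_squares n d s \<subseteq> (sums_of_squares n d r :: 'a mpoly set)"
proof (induction s)
  case 0
  then show ?case by (intro sums_of_squares_mono) simp
next
  case (Suc s)
  show ?case
  proof
    fix f :: "'a mpoly" assume "f \<in> sums_of_squares n d (Suc s)"
    then obtain p where p: "f = (\<Sum>i<s. p i ^ 2) + p s ^ 2" "\<And>i. i < Suc s \<Longrightarrow> p i \<in> forms n d"
      by (auto simp: sums_of_squares_def)
    have "(\<Sum>i<s. p i ^ 2) \<in> sums_of_squares n d s"
      using p(2) by (auto simp: sums_of_squares_def)
    then have "(\<Sum>i<s. p i ^ 2) \<in> sums_of_squares n d r" using Suc.IH by blast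
    then obtain q where q: "(\<Sum>i<s. p i ^ 2) = (\<Sum>i<r. q i ^ 2)" "\<And>i. i < r \<Longrightarrow> q i \<in> forms n d"
      by (auto simp: sums_of_squares_def)
    have "f = (\<Sum>i<Suc r. (q(r := p s)) i ^ 2)" by (simp add: p(1) q(1))
    moreover have "(q(r := p s)) i \<in> forms n d" if "i < Suc r" for i
      using that p(2) q(2) by (auto simp: less_Suc_eq)
    ultimately have "f \<in> sums_of_squares n d (Suc r)" unfolding sums_of_squares_def by blast
    then show "f \<in> sums_of_squares n d r" using assms by blast
  qed
qed

section \<open>Topology and Zariski density\<close>

text \<open>Block-diagonal coefficients: they make a sum of \<open>r\<close> squares one quadratic
  map in the variables (i, a), the coefficient at \<open>a\<close> of the i-th form.\<close>

definition sos_coeff ::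
  "(nat \<Rightarrow>\<^sub>0 nat) \<Rightarrow> nat \<times> (nat \<Rightarrow>\<^sub>0 nat) \<Rightarrow> nat \<times> (nat \<Rightarrow>\<^sub>0 nat) \<Rightarrow> 'a::field" where
  "sos_coeff m k l = (if fst k = fst l then conv_coeff m (snd k) (snd l) else 0)"

abbreviation sos_map ::
  "nat \<Rightarrow> nat \<Rightarrow> nat \<Rightarrow> (nat \<times> (nat \<Rightarrow>\<^sub>0 nat) \<Rightarrow> 'a) \<Rightarrow> (nat \<Rightarrow>\<^sub>0 nat) \<Rightarrow> 'a::field" where
  "sos_map n d r \<equiv> quadratic_map ({..<r} \<times> monomials n d) sos_coeff"

lemma sos_map_eq:
  "sos_map n d r x m = (\<Sum>i<r. quadratic_map (monomials n d) conv_coeff (\<lambda>a. x (i, a)) m)"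
proof -
  have "sos_map n d r x m = (\<Sum>i<r. \<Sum>a\<in>monomials n d. \<Sum>k<r. \<Sum>b\<in>monomials n d.
      sos_coeff m (i, a) (k, b) * (x (i, a) * x (k, b)))"
    unfolding bilinear_map_def sum.cartesian_product' ..
  also have "\<dots> = (\<Sum>i<r. \<Sum>a\<in>monomials n d. \<Sum>k<r. if k = i then
      \<Sum>b\<in>monomials n d. conv_coeff m a b * (x (i, a) * x (i, b)) else 0)"
    by (intro sum.cong refl) (auto simp: sos_coeff_def)
  finally show ?thesis by (simp add: bilinear_map_def)
qed

lemma sums_of_squares_iff_sos_map:
  fixes f :: "'a::field mpoly"
  shows "f \<in> sums_of_squares n d r \<longleftrightarrow> f \<in> forms n (2 * d) \<and>
    (\<exists>x. \<forall>m\<in>monomials n (2 * d). sos_map n d r x m = Poly_Mapping.lookup f m)"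
proof -
  have "(\<exists>x. \<forall>m\<in>monomials n (2 * d). Poly_Mapping.lookup f m =
      (\<Sum>i<r. quadratic_map (monomials n d) conv_coeff (x i) m)) \<longleftrightarrow>
    (\<exists>x. \<forall>m\<in>monomials n (2 * d). sos_map n d r x m = Poly_Mapping.lookup f m)" (is "?L \<longleftrightarrow> ?R")
  proof
    assume ?L
    then obtain x where x: "\<forall>m\<in>monomials n (2 * d). Poly_Mapping.lookup f m =
      (\<Sum>i<r. quadratic_map (monomials n d) conv_coeff (x i) m)" by blast
    have "sos_map n d r (\<lambda>k. x (fst k) (snd k)) m = Poly_Mapping.lookup f m"
      if "m \<in> monomials n (2 * d)" for m
      unfolding sos_map_eq using x that by simp
    then show ?R by blast
  next
    assume ?R
    then obtain x where x: "\<forall>m\<in>monomials n (2 * d). sos_map n d r x m = Poly_Mapping.lookup f m"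
      by blast
    show ?L by (rule exI[of _ "\<lambda>i a. x (i, a)"]) (use x in \<open>simp add: sos_map_eq\<close>)
  qed
  then show ?thesis unfolding sums_of_squares_iff by blast
qed

lemma form_of_sos_map: "form_of n (2 * d) (sos_map n d r x) \<in> sums_of_squares n d r"
  unfolding sums_of_squares_iff_sos_map by (auto simp: lookup_form_of)

text \<open>
  The leading monomials of the squares cannot cancel.
\<close>

lemma sos_map_anisotropic:
  fixes x :: "nat \<times> (nat \<Rightarrow>\<^sub>0 nat) \<Rightarrow> real"
  assumes "\<forall>m\<in>monomials n (2 * d). sos_map n d r x m = 0"
  shows "\<forall>k\<in>{..<r} \<times> monomials n d. x k = 0"
proof (rule ccontr)
  \<comment> \<open>All monomials occurring in any of the \<open>r\<close> forms; the largest is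
    taken in the linear order on exponent vectors, which is compatible with addition.\<close>
  define A where "A = {a \<in> monomials n d. \<exists>i<r. x (i, a) \<noteq> 0}"
  assume "\<not> ?thesis"
  then have "A \<noteq> {}" by (auto simp: A_def)
  moreover have "finite A" by (simp add: A_def)
  ultimately have max: "Max A \<in> A" "\<And>a. a \<in> A \<Longrightarrow> a \<le> Max A" by auto
  define m where "m = Max A"
  have m: "m \<in> monomials n d" using max(1) by (auto simp: A_def m_def)
  \<comment> \<open>If a + b = m + m with both a and b at most \<open>m\<close>, then a = b = m. The
    coefficient at \<open>m + m\<close> is thus a sum of real squares.\<close>
  have sq: "quadratic_map (monomials n d) conv_coeff (\<lambda>a. x (i, a)) (m + m) = (x (i, m))\<^sup>2"
    if i: "i < r" for i
  proof -
    have "conv_coeff (m + m) a b * (x (i, a) * x (i, b)) =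
        (if b = m then if a = m then (x (i, m))\<^sup>2 else 0 else 0)"
      if ab: "a \<in> monomials n d" "b \<in> monomials n d" for a b
    proof (cases "a + b = m + m \<and> x (i, a) * x (i, b) \<noteq> 0")
      case True
      then have "a \<in> A" "b \<in> A" using i ab by (auto simp: A_def)
      then have le: "a \<le> m" "b \<le> m" using max(2) by (auto simp: m_def)
      then have "a = m" "b = m"
        using True add_less_le_mono[of a m b m] add_le_less_mono[of a m b m] by (auto simp: order_le_less)
      then show ?thesis by (simp add: conv_coeff_def power2_eq_square)
    next
      case False
      then show ?thesis by (auto simp: conv_coeff_def)
    qed
    then have "quadratic_map (monomials n d) conv_coeff (\<lambda>a. x (i, a)) (m + m) =
        (\<Sum>a\<in>monomials n d. \<Sum>b\<in>monomials n d. if b = m then if a = m then (x (i, m))\<^sup>2 else 0 else 0)"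
      unfolding bilinear_map_def by (intro sum.cong refl)
    then show ?thesis using m by simp
  qed
  have "m + m \<in> monomials n (2 * d)" using monomials_add[OF m m] by (simp add: mult_2)
  then have "sos_map n d r x (m + m) = 0" using assms by blast
  then have "(\<Sum>i<r. (x (i, m))\<^sup>2) = 0" by (simp add: sos_map_eq sq)
  then have "x (i, m) = 0" if "i < r" for i using that by (subst (asm) sum_nonneg_eq_0_iff) auto
  then show False using max(1) by (auto simp: A_def m_def)
qed

section \<open>The Euclidean topology on forms\<close>

abbreviation form_dist :: "nat \<Rightarrow> nat \<Rightarrow> real mpoly \<Rightarrow> real mpoly \<Rightarrow> real" where
  "form_dist n e f g \<equiv> l1norm (monomials n e) (\<lambda>m. Poly_Mapping.lookup g m - Poly_Mapping.lookup f m)"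

lemma openin_forms_topology_ball:
  "openin (forms_topology n e) {g \<in> forms n e. form_dist n e f g < \<epsilon>}"
proof -
  let ?U = "{x. l1norm (monomials n e) (\<lambda>m. x m - Poly_Mapping.lookup f m) < \<epsilon>}"
  have "open ?U" unfolding l1norm_def by (intro open_Collect_less continuous_intros)
  then show ?thesis
    unfolding forms_topology_def openin_pullback_topology by (intro exI[of _ ?U]) auto
qed

text \<open>A basic open set constrains coefficients separately. Off \<open>monomials n e\<close>
  all forms of degree \<open>e\<close> agree, so a minimum over finitely many radii
  suffices.\<close>

lemma openin_forms_topology_contains_ball:
  assumes "openin (forms_topology n e) T" "f \<in> T"
  shows "\<exists>\<epsilon>>0. \<forall>g\<in>forms n e. form_dist n e f g < \<epsilon> \<longrightarrow> g \<in> T"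
proof -
  obtain U where U: "open U" "T = Poly_Mapping.lookup -` U \<inter> forms n e"
    using assms(1) by (auto simp: forms_topology_def openin_pullback_topology)
  have "openin (product_topology (\<lambda>_. euclidean) UNIV) U" "Poly_Mapping.lookup f \<in> U"
    using U assms(2) by (auto simp: euclidean_product_topology)
  from product_topology_open_contains_basis[OF this] obtain X where X: "Poly_Mapping.lookup f \<in> (\<Pi>\<^sub>E m\<in>UNIV. X m)"
      "\<And>m. open (X m)" "(\<Pi>\<^sub>E m\<in>UNIV. X m) \<subseteq> U"
    by auto
  have "\<exists>\<epsilon>>0. ball (Poly_Mapping.lookup f m) \<epsilon> \<subseteq> X m" for m
    using X(1) X(2)[of m] open_contains_ball[of "X m"] by (auto simp: PiE_iff)
  then obtain \<epsilon> where \<epsilon>: "\<And>m. \<epsilon> m > 0" "\<And>m. ball (Poly_Mapping.lookup f m) (\<epsilon> m) \<subseteq> X m" by metis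
  \<comment> \<open>The 1 keeps the set nonempty when there are no monomials.\<close>
  define \<delta> where "\<delta> = Min (insert 1 (\<epsilon> ` monomials n e))"
  have \<delta>: "\<delta> > 0" "\<And>m. m \<in> monomials n e \<Longrightarrow> \<delta> \<le> \<epsilon> m" using \<epsilon>(1) by (auto simp: \<delta>_def)
  have "g \<in> T" if g: "g \<in> forms n e" "form_dist n e f g < \<delta>" for g
  proof -
    have "Poly_Mapping.lookup g m \<in> X m" for m
    proof (cases "m \<in> monomials n e")
      case True
      then have "\<bar>Poly_Mapping.lookup g m - Poly_Mapping.lookup f m\<bar> < \<epsilon> m"
        using abs_le_l1norm[OF finite_monomials True, of "\<lambda>m. Poly_Mapping.lookup g m - Poly_Mapping.lookup f m"]
          g(2) \<delta>(2)[OF True] by linarith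
      then show ?thesis using \<epsilon>(2)[of m] by (auto simp: dist_real_def abs_minus_commute)
    next
      case False
      moreover have "f \<in> forms n e" using assms(2) U(2) by simp
      ultimately have "Poly_Mapping.lookup g m = Poly_Mapping.lookup f m"
        using g(1) by (simp add: lookup_form_outside)
      then show ?thesis using X(1) by (auto simp: PiE_iff)
    qed
    then show ?thesis using X(3) g(1) U(2) by (auto simp: PiE_iff)
  qed
  then show ?thesis using \<delta>(1) by blast
qed

section \<open>Zariski density and algebraic independence\<close>

lemma coeff_polynomials_imp_polyfun:
  assumes "\<psi> \<in> coeff_polynomials"
  shows "\<exists>k p. polyfun (monomials n e) k p \<and> (\<forall>f\<in>forms n e. \<psi> f = p (Poly_Mapping.lookup f))"
  using assms
proof induction
  case (const c)
  then show ?case by (intro exI[of _ 0] exI[of _ "\<lambda>x. c"]) (auto intro: polyfun.const)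
next
  case (coeff m)
  show ?case
  proof (cases "m \<in> monomials n e")
    case True
    then show ?thesis
      by (intro exI[of _ "Suc 0"] exI[of _ "\<lambda>x. x m"]) (auto intro: polyfun.coord)
  next
    case False
    then show ?thesis
      by (intro exI[of _ 0] exI[of _ "\<lambda>x. 0"]) (auto intro: polyfun.const simp: lookup_form_outside)
  qed
next
  case (add \<phi> \<psi>)
  then obtain k p l q where p: "polyfun (monomials n e) k p" "polyfun (monomials n e) l q"
    "\<forall>f\<in>forms n e. \<phi> f = p (Poly_Mapping.lookup f)" "\<forall>f\<in>forms n e. \<psi> f = q (Poly_Mapping.lookup f)"
    by blast
  have "polyfun (monomials n e) (max k l) (\<lambda>x. p x + q x)"
    by (intro polyfun.add) (rule polyfun_mono[OF p(1)], simp, rule polyfun_mono[OF p(2)], simp)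
  then show ?case using p(3,4) by (intro exI[of _ "max k l"] exI[of _ "\<lambda>x. p x + q x"]) auto
next
  case (mult \<phi> \<psi>)
  then obtain k p l q where p: "polyfun (monomials n e) k p" "polyfun (monomials n e) l q"
    "\<forall>f\<in>forms n e. \<phi> f = p (Poly_Mapping.lookup f)" "\<forall>f\<in>forms n e. \<psi> f = q (Poly_Mapping.lookup f)"
    by blast
  then show ?case
    using polyfun.mult[OF p(1,2)] by (intro exI[of _ "k + l"] exI[of _ "\<lambda>x. p x * q x"]) auto
qed

lemma polyfun_imp_coeff_polynomials:
  assumes "polyfun I k p"
  shows "(\<lambda>f. p (Poly_Mapping.lookup f)) \<in> coeff_polynomials"
  using assms by induction (auto intro: coeff_polynomials.intros)

text \<open>Closed sets are intersections of zero sets of single polynomials, so density can be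
  tested on one polynomial at a time.\<close>

lemma zariski_dense_in_forms_iff:
  fixes S :: "'a::field mpoly set"
  assumes "S \<subseteq> forms n e"
  shows "zariski_dense_in_forms n e S \<longleftrightarrow>
    (\<forall>\<psi>\<in>coeff_polynomials. (\<forall>f\<in>S. \<psi> f = 0) \<longrightarrow> (\<forall>f\<in>forms n e. \<psi> f = 0))"
proof
  assume dense: "zariski_dense_in_forms n e S"
  show "\<forall>\<psi>\<in>coeff_polynomials. (\<forall>f\<in>S. \<psi> f = 0) \<longrightarrow> (\<forall>f\<in>forms n e. \<psi> f = 0)"
  proof (intro ballI impI)
    fix \<psi> :: "'a mpoly \<Rightarrow> 'a" and f :: "'a mpoly"
    assume \<psi>: "\<psi> \<in> coeff_polynomials" "\<forall>f\<in>S. \<psi> f = 0" and f: "f \<in> forms n e"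
    define Z where "Z = {f \<in> forms n e. \<forall>\<phi>\<in>{\<psi>}. \<phi> f = 0}"
    have "zariski_closed_in_forms n e Z"
      unfolding zariski_closed_in_forms_def Z_def using \<psi>(1) by (intro exI[of _ "{\<psi>}"]) auto
    moreover have "S \<subseteq> Z" using \<psi>(2) assms by (auto simp: Z_def)
    ultimately have "f \<in> Z" using dense f unfolding zariski_dense_in_forms_def by blast
    then show "\<psi> f = 0" by (simp add: Z_def)
  qed
next
  assume van: "\<forall>\<psi>\<in>coeff_polynomials. (\<forall>f\<in>S. \<psi> f = 0) \<longrightarrow> (\<forall>f\<in>forms n e. \<psi> f = 0)"
  have "forms n e \<subseteq> Z" if "zariski_closed_in_forms n e Z" "S \<subseteq> Z" for Z :: "'a mpoly set"
  proof -
    obtain \<Phi> where "\<Phi> \<subseteq> coeff_polynomials" "Z = {f \<in> forms n e. \<forall>\<phi>\<in>\<Phi>. \<phi> f = 0}"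
      using \<open>zariski_closed_in_forms n e Z\<close> unfolding zariski_closed_in_forms_def by blast
    then show ?thesis using van \<open>S \<subseteq> Z\<close> by blast
  qed
  \<comment> \<open>This member of the family keeps the intersection inside
    \<open>forms n e\<close>.\<close>
  moreover have "zariski_closed_in_forms n e (forms n e :: 'a mpoly set)"
    unfolding zariski_closed_in_forms_def by (intro exI[of _ "{}"]) auto
  ultimately show "zariski_dense_in_forms n e S"
    unfolding zariski_dense_in_forms_def using assms by blast
qed

text \<open>The sums of squares are parametrized by \<open>sos_map\<close>, so a polynomial vanishes
  on them exactly when it is a relation among the components of \<open>sos_map\<close>.\<close>

lemma zariski_dense_sums_of_squares_iff:
  "zariski_dense_in_forms n (2 * d) (sums_of_squares n d r :: 'a::field mpoly set) \<longleftrightarrow>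
    alg_independent (monomials n (2 * d)) (\<lambda>m (x :: _ \<Rightarrow> 'a). sos_map n d r x m)"
proof -
  have sub: "sums_of_squares n d r \<subseteq> (forms n (2 * d) :: 'a mpoly set)"
    by (auto simp: sums_of_squares_iff)
  show ?thesis
    unfolding zariski_dense_in_forms_iff[OF sub]
  proof
    assume van: "\<forall>\<psi>\<in>coeff_polynomials. (\<forall>f\<in>sums_of_squares n d r. \<psi> f = 0) \<longrightarrow>
      (\<forall>f\<in>forms n (2 * d). \<psi> f = (0 :: 'a))"
    show "alg_independent (monomials n (2 * d)) (\<lambda>m (x :: _ \<Rightarrow> 'a). sos_map n d r x m)"
      unfolding alg_independent_def
    proof (intro allI impI, elim conjE)
      fix k and p :: "((nat \<Rightarrow>\<^sub>0 nat) \<Rightarrow> 'a) \<Rightarrow> 'a" and y :: "(nat \<Rightarrow>\<^sub>0 nat) \<Rightarrow> 'a"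
      assume p: "polyfun (monomials n (2 * d)) k p" "\<forall>x. p (\<lambda>m. sos_map n d r x m) = 0"
      have "p (Poly_Mapping.lookup f) = 0" if f: "f \<in> sums_of_squares n d r" for f
      proof -
        obtain x where x: "\<forall>m\<in>monomials n (2 * d). sos_map n d r x m = Poly_Mapping.lookup f m"
          using f unfolding sums_of_squares_iff_sos_map by blast
        have "p (Poly_Mapping.lookup f) = p (\<lambda>m. sos_map n d r x m)"
          by (rule polyfun_cong_coords[OF p(1)]) (simp add: x)
        then show ?thesis using p(2) by simp
      qed
      then have "p (Poly_Mapping.lookup (form_of n (2 * d) y)) = 0"
        using van[THEN bspec, OF polyfun_imp_coeff_polynomials[OF p(1)]] form_of_in_forms by blast
      moreover have "p (Poly_Mapping.lookup (form_of n (2 * d) y)) = p y"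
        by (rule polyfun_cong_coords[OF p(1)]) (simp add: lookup_form_of)
      ultimately show "p y = 0" by simp
    qed
  next
    assume indep: "alg_independent (monomials n (2 * d)) (\<lambda>m (x :: _ \<Rightarrow> 'a). sos_map n d r x m)"
    show "\<forall>\<psi>\<in>coeff_polynomials. (\<forall>f\<in>sums_of_squares n d r. \<psi> f = 0) \<longrightarrow>
      (\<forall>f\<in>forms n (2 * d). \<psi> f = (0 :: 'a))"
    proof (intro ballI impI)
      fix \<psi> :: "'a mpoly \<Rightarrow> 'a" and f :: "'a mpoly"
      assume \<psi>: "\<psi> \<in> coeff_polynomials" "\<forall>f\<in>sums_of_squares n d r. \<psi> f = (0 :: 'a)"
        and f: "f \<in> forms n (2 * d)"
      obtain k p where p: "polyfun (monomials n (2 * d)) k p"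
          "\<forall>f\<in>forms n (2 * d). \<psi> f = p (Poly_Mapping.lookup f)"
        using coeff_polynomials_imp_polyfun[OF \<psi>(1)] by blast
      have "p (\<lambda>m. sos_map n d r x m) = 0" for x
      proof -
        have "p (\<lambda>m. sos_map n d r x m) = p (Poly_Mapping.lookup (form_of n (2 * d) (sos_map n d r x)))"
          by (rule polyfun_cong_coords[OF p(1)]) (simp add: lookup_form_of)
        also have "\<dots> = \<psi> (form_of n (2 * d) (sos_map n d r x))" using p(2) by simp
        also have "\<dots> = 0" using \<psi>(2) form_of_sos_map by blast
        finally show ?thesis .
      qed
      then show "\<psi> f = 0" using alg_independentD[OF indep p(1)] p(2) f by simp
    qed
  qed
qed

lemma sos_map_of_real:
  "sos_map n d r (\<lambda>k. complex_of_real (x k)) m = complex_of_real (sos_map n d r x m)"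
proof -
  have "sos_coeff m k l = complex_of_real (sos_coeff m k l)" for k l
    by (simp add: sos_coeff_def conv_coeff_def)
  then show ?thesis by (simp add: bilinear_map_def)
qed

text \<open>The complexification of a real relation, composed with \<open>sos_map\<close>, vanishes
  at real points and therefore everywhere.\<close>

lemma alg_independent_sos_map_real:
  assumes "alg_independent J (\<lambda>m (x :: _ \<Rightarrow> complex). sos_map n d r x m)"
  shows "alg_independent J (\<lambda>m (x :: _ \<Rightarrow> real). sos_map n d r x m)"
  unfolding alg_independent_def
proof (intro allI impI, elim conjE)
  fix k and p :: "((nat \<Rightarrow>\<^sub>0 nat) \<Rightarrow> real) \<Rightarrow> real" and y :: "(nat \<Rightarrow>\<^sub>0 nat) \<Rightarrow> real"
  assume p: "polyfun J k p" "\<forall>x. p (\<lambda>m. sos_map n d r x m) = 0"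
  obtain q :: "((nat \<Rightarrow>\<^sub>0 nat) \<Rightarrow> complex) \<Rightarrow> complex" where q: "polyfun J k q"
      "\<forall>x. q (\<lambda>i. of_real (x i)) = of_real (p x)"
    using polyfun_complexify[OF p(1)] by blast
  have "polyfun ({..<r} \<times> monomials n d) (k * 2) (\<lambda>x. q (\<lambda>m. sos_map n d r x m))"
    by (rule polyfun_compose[OF q(1) polyfun_quadratic_map])
  moreover have "q (\<lambda>m. sos_map n d r (\<lambda>k. complex_of_real (x k)) m) = 0" for x
    unfolding sos_map_of_real using p(2) q(2) by simp
  ultimately have "q (\<lambda>m. sos_map n d r x m) = 0" for x
    by (rule polyfun_zero_of_real_points)
  then have "q (\<lambda>i. of_real (y i)) = 0" by (rule alg_independentD[OF assms q(1)])
  then show "p y = 0" using q(2) by simp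
qed

text \<open>A complex relation vanishes on the ball. The line from \<open>f\<close> to any real
  point starts inside the ball, where it has infinitely many zeros of the relation; so the relation
  vanishes at all real points, hence at all complex ones.\<close>

lemma alg_independent_if_interior:
  assumes f: "f \<in> forms n (2 * d)" and "\<epsilon> > 0"
    and ball: "\<And>g. g \<in> forms n (2 * d) \<Longrightarrow> form_dist n (2 * d) f g < \<epsilon> \<Longrightarrow> g \<in> sums_of_squares n d r"
  shows "alg_independent (monomials n (2 * d)) (\<lambda>m (x :: _ \<Rightarrow> complex). sos_map n d r x m)"
  unfolding alg_independent_def
proof (intro allI impI, elim conjE)
  let ?M = "monomials n (2 * d)"
  fix k and p :: "((nat \<Rightarrow>\<^sub>0 nat) \<Rightarrow> complex) \<Rightarrow> complex" and z :: "(nat \<Rightarrow>\<^sub>0 nat) \<Rightarrow> complex"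
  assume p: "polyfun ?M k p" "\<forall>x. p (\<lambda>m. sos_map n d r x m) = 0"
  have p_sos: "p (\<lambda>m. complex_of_real (y m)) = 0" if "form_of n (2 * d) y \<in> sums_of_squares n d r" for y
  proof -
    have "\<exists>x. \<forall>m\<in>?M. sos_map n d r x m = y m"
      using that unfolding sums_of_squares_iff_sos_map by (simp add: lookup_form_of)
    then obtain x where x: "\<forall>m\<in>?M. sos_map n d r x m = y m" by blast
    have "p (\<lambda>m. complex_of_real (y m)) = p (\<lambda>m. sos_map n d r (\<lambda>k. complex_of_real (x k)) m)"
      by (rule polyfun_cong_coords[OF p(1)]) (simp add: x sos_map_of_real)
    then show ?thesis using p(2) by simp
  qed
  have "p (\<lambda>m. complex_of_real (y m)) = 0" for y
  proof (rule ccontr)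
    assume ne: "p (\<lambda>m. complex_of_real (y m)) \<noteq> 0"
    define v where "v m = y m - Poly_Mapping.lookup f m" for m
    \<comment> \<open>Parameters below \<open>\<delta>\<close> stay in the ball; adding 1 avoids
      division by 0 when \<open>v\<close> vanishes on the monomials.\<close>
    define \<delta> where "\<delta> = \<epsilon> / (l1norm ?M v + 1)"
    have v1: "l1norm ?M v + 1 > 0" using l1norm_nonneg[of ?M v] by linarith
    have "\<delta> > 0" using \<open>\<epsilon> > 0\<close> v1 by (simp add: \<delta>_def)
    let ?Z = "{s. p (\<lambda>m. of_real (Poly_Mapping.lookup f m) + s * of_real (v m)) = 0}"
    have "finite ?Z"
      by (rule polyfun_line_finite_zeros[OF p(1), of _ 1]) (use ne in \<open>simp add: v_def\<close>)
    moreover have "of_real ` {0<..<\<delta>} \<subseteq> ?Z"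
    proof
      fix c assume "c \<in> complex_of_real ` {0<..<\<delta>}"
      then obtain s where s: "c = of_real s" "0 < s" "s < \<delta>" by auto
      let ?y = "\<lambda>m. Poly_Mapping.lookup f m + s * v m"
      have "form_dist n (2 * d) f (form_of n (2 * d) ?y) = l1norm ?M (\<lambda>m. s * v m)"
        by (rule l1norm_cong) (simp add: lookup_form_of)
      also have "\<dots> = s * l1norm ?M v" using s by (simp add: l1norm_scale)
      also have "\<dots> \<le> s * (l1norm ?M v + 1)" using s by simp
      also have "\<dots> < \<epsilon>" using s(3) v1 by (simp add: \<delta>_def field_simps)
      finally have "form_of n (2 * d) ?y \<in> sums_of_squares n d r" by (intro ball) auto
      from p_sos[OF this] show "c \<in> ?Z" using s(1) by simp
    qed
    ultimately have "finite (complex_of_real ` {0<..<\<delta>})" using finite_subset by blast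
    then show False
      using finite_imageD[of complex_of_real "{0<..<\<delta>}"] infinite_Ioo[OF \<open>\<delta> > 0\<close>]
      by (auto simp: inj_on_def)
  qed
  then show "p z = 0" by (rule polyfun_zero_of_real_points[OF p(1)])
qed

section \<open>Typical lengths\<close>

lemma sums_of_squares_closed:
  assumes f: "f \<in> forms n (2 * d)" "f \<notin> sums_of_squares n d r"
  shows "\<exists>\<epsilon>>0. \<forall>g\<in>sums_of_squares n d r. \<epsilon> \<le> form_dist n (2 * d) f g"
proof -
  have "\<nexists>x. \<forall>m\<in>monomials n (2 * d). sos_map n d r x m = Poly_Mapping.lookup f m"
    using f unfolding sums_of_squares_iff_sos_map by blast
  from anisotropic_quadratic_image_closed[OF _ _ _ this]
  obtain \<epsilon> where \<epsilon>: "\<epsilon> > 0"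
      "\<forall>x. \<epsilon> \<le> l1norm (monomials n (2 * d)) (\<lambda>m. sos_map n d r x m - Poly_Mapping.lookup f m)"
    using sos_map_anisotropic[of n d r] by auto
  have "\<epsilon> \<le> form_dist n (2 * d) f g" if "g \<in> sums_of_squares n d r" for g
  proof -
    obtain x where "\<forall>m\<in>monomials n (2 * d). sos_map n d r x m = Poly_Mapping.lookup g m"
      using \<open>g \<in> sums_of_squares n d r\<close> unfolding sums_of_squares_iff_sos_map by blast
    then have "form_dist n (2 * d) f g =
        l1norm (monomials n (2 * d)) (\<lambda>m. sos_map n d r x m - Poly_Mapping.lookup f m)"
      by (intro l1norm_cong) simp
    then show ?thesis using \<epsilon>(2) by simp
  qed
  then show ?thesis using \<epsilon>(1) by blast
qed

lemma sums_of_squares_interior_dense: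
  assumes dense: "zariski_dense_in_forms n (2 * d) (sums_of_squares n d r :: complex mpoly set)"
    and f: "f \<in> sums_of_squares n d r" and "\<epsilon> > 0"
  shows "\<exists>g\<in>sums_of_squares n d r. form_dist n (2 * d) f g < \<epsilon> \<and>
    (\<exists>\<delta>>0. \<forall>h\<in>forms n (2 * d). form_dist n (2 * d) g h < \<delta> \<longrightarrow> h \<in> sums_of_squares n d r)"
proof -
  let ?M = "monomials n (2 * d)"
  have "alg_independent ?M (\<lambda>m (x :: _ \<Rightarrow> real). sos_map n d r x m)"
    using dense alg_independent_sos_map_real by (simp add: zariski_dense_sums_of_squares_iff)
  note interior = quadratic_image_interior_dense[OF _ _ this \<open>\<epsilon> > 0\<close>, simplified]
  obtain x where x: "\<forall>m\<in>?M. sos_map n d r x m = Poly_Mapping.lookup f m"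
    using f unfolding sums_of_squares_iff_sos_map by blast
  obtain q \<delta> where q: "l1norm ?M (\<lambda>m. sos_map n d r q m - sos_map n d r x m) < \<epsilon>" "\<delta> > 0"
      "\<And>y. l1norm ?M (\<lambda>m. y m - sos_map n d r q m) < \<delta> \<Longrightarrow> \<exists>x. \<forall>m\<in>?M. sos_map n d r x m = y m"
    using interior[of x] by blast
  define g where "g = form_of n (2 * d) (sos_map n d r q)"
  have g: "Poly_Mapping.lookup g m = sos_map n d r q m" if "m \<in> ?M" for m
    using that by (simp add: g_def lookup_form_of)
  have "form_dist n (2 * d) f g = l1norm ?M (\<lambda>m. sos_map n d r q m - sos_map n d r x m)"
    by (rule l1norm_cong) (simp add: g x)
  moreover have "h \<in> sums_of_squares n d r"
    if h: "h \<in> forms n (2 * d)" "form_dist n (2 * d) g h < \<delta>" for h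
  proof -
    have "form_dist n (2 * d) g h = l1norm ?M (\<lambda>m. Poly_Mapping.lookup h m - sos_map n d r q m)"
      by (rule l1norm_cong) (simp add: g)
    then show ?thesis using q(3)[of "Poly_Mapping.lookup h"] h by (simp add: sums_of_squares_iff_sos_map)
  qed
  ultimately show ?thesis
    using q(1,2) form_of_sos_map[of n d r q] by (intro bexI[of _ g]) (auto simp: g_def)
qed

lemma interior_sums_of_squares_imp_zariski_dense:
  assumes "f \<in> forms n (2 * d)" "\<epsilon> > 0"
    and "\<And>g. g \<in> forms n (2 * d) \<Longrightarrow> form_dist n (2 * d) f g < \<epsilon> \<Longrightarrow> g \<in> sums_of_squares n d r"
  shows "zariski_dense_in_forms n (2 * d) (sums_of_squares n d r :: complex mpoly set)"
  using alg_independent_if_interior[OF assms] by (simp add: zariski_dense_sums_of_squares_iff)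

text \<open>Polarization provides a dense set of sums of squares, so the \<open>LEAST\<close> is
  attained; monotonicity makes density equivalent to an inequality.\<close>

lemma generic_sos_length:
  shows generic_sos_length_ge_1: "1 \<le> generic_sos_length n d"
    and zariski_dense_iff_generic_sos_length_le: "1 \<le> r \<Longrightarrow>
      zariski_dense_in_forms n (2 * d) (sums_of_squares n d r :: complex mpoly set) \<longleftrightarrow>
        generic_sos_length n d \<le> r"
proof -
  let ?D = "\<lambda>r. zariski_dense_in_forms n (2 * d) (sums_of_squares n d r :: complex mpoly set)"
  have sub: "sums_of_squares n d s \<subseteq> (forms n (2 * d) :: complex mpoly set)" for s
    by (auto simp: sums_of_squares_iff)
  have mono: "?D s" if "?D r" "r \<le> s" for r s
    using that(1) sums_of_squares_mono[OF that(2), of n d]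
    unfolding zariski_dense_in_forms_iff[OF sub] by blast
  have "?D (2 * card (monomials n (2 * d)))"
    unfolding complex_forms_are_sums_of_squares by (subst zariski_dense_in_forms_iff) auto
  \<comment> \<open>The successor meets the constraint \<open>1 \<le> t\<close> even when there are
    no monomials.\<close>
  then have "1 \<le> Suc (2 * card (monomials n (2 * d))) \<and> ?D (Suc (2 * card (monomials n (2 * d))))"
    using mono by simp
  then have "1 \<le> generic_sos_length n d \<and> ?D (generic_sos_length n d)"
    unfolding generic_sos_length_def by (rule LeastI)
  then show "1 \<le> generic_sos_length n d" "1 \<le> r \<Longrightarrow> ?D r \<longleftrightarrow> generic_sos_length n d \<le> r"
    using mono unfolding generic_sos_length_def by (blast, blast intro: Least_le)
qed

section \<open>Length and Pythagoras number\<close>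

lemma sos_length_le_iff:
  assumes "f \<in> sos_cone n d"
  shows "sos_length n d f \<le> r \<longleftrightarrow> f \<in> sums_of_squares n d r"
proof
  have "f \<in> sums_of_squares n d (sos_length n d f)"
    using assms unfolding sos_length_def sos_cone_def by (auto intro: LeastI)
  then show "f \<in> sums_of_squares n d r" if "sos_length n d f \<le> r"
    using sums_of_squares_mono[OF that] by blast
  show "sos_length n d f \<le> r" if "f \<in> sums_of_squares n d r"
    unfolding sos_length_def using that by (rule Least_le)
qed

lemma sos_cone_upto_eq: "sos_cone_upto n d r = sums_of_squares n d r"
proof -
  have "sums_of_squares n d r \<subseteq> sos_cone n d" by (auto simp: sos_cone_def)
  then show ?thesis unfolding sos_cone_upto_def using sos_length_le_iff by blast
qed

text \<open>Caratheodory's bound makes the set of lengths finite, so the supremum is a maximum. The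
  last two properties say that \<open>f\<close> has length exactly \<open>p\<close>.\<close>

lemma pythagoras_number_attained:
  obtains p and f :: "real mpoly" where "pythagoras_number n d = enat p"
    "\<forall>r. sums_of_squares n d r \<subseteq> (sums_of_squares n d p :: real mpoly set)"
    "f \<in> sums_of_squares n d p" "\<forall>r. f \<in> sums_of_squares n d r \<longrightarrow> p \<le> r"
proof -
  define L where "L = sos_length n d ` sos_cone n d"
  have "0 \<in> (sums_of_squares n d 0 :: real mpoly set)" by (auto simp: sums_of_squares_def)
  then have "L \<noteq> {}" by (auto simp: L_def sos_cone_def)
  have "sos_length n d f \<le> card (monomials n (2 * d))" if "f \<in> sos_cone n d" for f
    using that sums_of_squares_caratheodory unfolding sos_length_le_iff[OF that]
    by (auto simp: sos_cone_def)
  then have "L \<subseteq> {..card (monomials n (2 * d))}" by (auto simp: L_def)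
  then have "finite L" using finite_subset by blast
  then have Max: "Max L \<in> L" "\<And>l. l \<in> L \<Longrightarrow> l \<le> Max L" using \<open>L \<noteq> {}\<close> by auto
  obtain f where f: "f \<in> sos_cone n d" "sos_length n d f = Max L" using Max(1) by (auto simp: L_def)
  have "pythagoras_number n d = enat (Max L)"
    unfolding pythagoras_number_def
  proof (rule antisym)
    show "(SUP f\<in>sos_cone n d. enat (sos_length n d f)) \<le> enat (Max L)"
      using Max(2) by (intro SUP_least) (simp add: L_def)
    show "enat (Max L) \<le> (SUP f\<in>sos_cone n d. enat (sos_length n d f))"
      using f by (intro SUP_upper2[of f]) auto
  qed
  moreover have "\<forall>r. sums_of_squares n d r \<subseteq> (sums_of_squares n d (Max L) :: real mpoly set)"
  proof (intro allI subsetI)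
    fix r and g :: "real mpoly"
    assume "g \<in> sums_of_squares n d r"
    then have "g \<in> sos_cone n d" by (auto simp: sos_cone_def)
    then show "g \<in> sums_of_squares n d (Max L)"
      using Max(2)[of "sos_length n d g"] by (subst sos_length_le_iff[symmetric]) (auto simp: L_def)
  qed
  moreover have "f \<in> sums_of_squares n d (Max L)" "\<forall>r. f \<in> sums_of_squares n d r \<longrightarrow> Max L \<le> r"
    using f sos_length_le_iff[OF f(1)] by auto
  ultimately show ?thesis by (rule that)
qed

text \<open>Yields p \<ge> 1, required because density is compared with \<open>t\<close> only for at
  least one square. The witness is the square of the d-th power of the variable with index
  0.\<close>

lemma sums_of_squares_1_not_subset_0:
  assumes "n \<ge> 1"
  shows "\<not> sums_of_squares n d 1 \<subseteq> (sums_of_squares n d 0 :: real mpoly set)"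
proof -
  define m :: "nat \<Rightarrow>\<^sub>0 nat" where "m = Poly_Mapping.single 0 d"
  define p :: "real mpoly" where "p = Poly_Mapping.single m 1"
  have "m \<in> monomials n d"
    using assms by (auto simp: m_def monomials_def lookup_single when_def sum.delta)
  then have "p \<in> forms n d" by (auto simp: p_def forms_eq)
  then have "p ^ 2 \<in> sums_of_squares n d 1"
    unfolding sums_of_squares_def by (auto intro!: exI[of _ "\<lambda>_. p"])
  moreover have "p ^ 2 = Poly_Mapping.single (m + m) 1" by (simp add: p_def power2_eq_square mult_single)
  then have "Poly_Mapping.lookup (p ^ 2) (m + m) \<noteq> 0" by simp
  then have "p ^ 2 \<noteq> 0" by (metis lookup_zero)
  then have "p ^ 2 \<notin> sums_of_squares n d 0" by (simp add: sums_of_squares_def)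
  ultimately show ?thesis by blast
qed

theorem corollary2p5:
  fixes n d :: nat
  assumes "n \<ge> 1" and "d \<ge> 1"
  shows "enat (generic_sos_length n d) \<le> pythagoras_number n d \<and>
    enat ` typical_sos_lengths n d = {enat (generic_sos_length n d)..pythagoras_number n d}"
proof -
  define t where "t = generic_sos_length n d"
  define \<Sigma> where "\<Sigma> r = (sums_of_squares n d r :: real mpoly set)" for r
  have sub: "\<Sigma> r \<subseteq> forms n (2 * d)" for r by (auto simp: \<Sigma>_def sums_of_squares_iff)
  have mono: "r \<le> s \<Longrightarrow> \<Sigma> r \<subseteq> \<Sigma> s" for r s unfolding \<Sigma>_def by (rule sums_of_squares_mono)
  obtain p fp where p: "pythagoras_number n d = enat p" "\<forall>r. \<Sigma> r \<subseteq> \<Sigma> p"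
      "fp \<in> \<Sigma> p" "\<forall>r. fp \<in> \<Sigma> r \<longrightarrow> p \<le> r"
    using pythagoras_number_attained[of n d] unfolding \<Sigma>_def by blast
  have typical_iff: "r \<in> typical_sos_lengths n d \<longleftrightarrow> t \<le> r \<and> r \<le> p" for r
  proof
    assume "r \<in> typical_sos_lengths n d"
    then have "1 \<le> r" "forms_topology n (2 * d) interior_of (\<Sigma> r - \<Sigma> (r - 1)) \<noteq> {}"
      by (auto simp: typical_sos_lengths_def sos_cone_upto_eq \<Sigma>_def)
    then obtain f T where T: "openin (forms_topology n (2 * d)) T" "f \<in> T" "T \<subseteq> \<Sigma> r - \<Sigma> (r - 1)"
      by (auto simp: interior_of_def)
    obtain \<epsilon> where \<epsilon>: "\<epsilon> > 0" "\<And>g. g \<in> forms n (2 * d) \<Longrightarrow> form_dist n (2 * d) f g < \<epsilon> \<Longrightarrow> g \<in> T"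
      using openin_forms_topology_contains_ball[OF T(1,2)] by blast
    have "zariski_dense_in_forms n (2 * d) (sums_of_squares n d r :: complex mpoly set)"
      by (rule interior_sums_of_squares_imp_zariski_dense[OF _ \<epsilon>(1)])
        (use \<epsilon>(2) T sub[of r] in \<open>auto simp: \<Sigma>_def\<close>)
    then have "t \<le> r" unfolding t_def using zariski_dense_iff_generic_sos_length_le[OF \<open>1 \<le> r\<close>] by blast
    \<comment> \<open>If p \<le> r - 1 held, \<open>f\<close> would lie in \<Sigma>(r-1).\<close>
    moreover have "f \<in> \<Sigma> p" "f \<notin> \<Sigma> (r - 1)" using T p(2) by auto
    then have "\<not> p \<le> r - 1" using mono by blast
    ultimately show "t \<le> r \<and> r \<le> p" by simp
  next
    assume r: "t \<le> r \<and> r \<le> p"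
    then have "1 \<le> r" using generic_sos_length_ge_1[of n d] by (simp add: t_def)
    have "\<not> \<Sigma> r \<subseteq> \<Sigma> (r - 1)"
    proof
      assume "\<Sigma> r \<subseteq> \<Sigma> (r - 1)"
      then have "\<Sigma> p \<subseteq> \<Sigma> (r - 1)"
        using sums_of_squares_stationary[of n d "r - 1" p] \<open>1 \<le> r\<close> by (simp add: \<Sigma>_def)
      then have "p \<le> r - 1" using p(3,4) by blast
      then show False using r \<open>1 \<le> r\<close> by linarith
    qed
    then obtain f where f: "f \<in> \<Sigma> r" "f \<notin> \<Sigma> (r - 1)" by blast
    obtain \<epsilon> where \<epsilon>: "\<epsilon> > 0" "\<forall>g\<in>\<Sigma> (r - 1). \<epsilon> \<le> form_dist n (2 * d) f g"
      using sums_of_squares_closed[of f n d "r - 1"] f sub[of r] by (auto simp: \<Sigma>_def)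
    have "zariski_dense_in_forms n (2 * d) (sums_of_squares n d r :: complex mpoly set)"
      using r \<open>1 \<le> r\<close> by (simp add: zariski_dense_iff_generic_sos_length_le t_def)
    from sums_of_squares_interior_dense[OF this f(1)[unfolded \<Sigma>_def] \<epsilon>(1)]
    obtain g \<delta> where g: "g \<in> \<Sigma> r" "form_dist n (2 * d) f g < \<epsilon>" "\<delta> > 0"
        "\<And>h. h \<in> forms n (2 * d) \<Longrightarrow> form_dist n (2 * d) g h < \<delta> \<Longrightarrow> h \<in> \<Sigma> r"
      by (auto simp: \<Sigma>_def)
    have "g \<notin> \<Sigma> (r - 1)" using g(2) \<epsilon>(2) by (meson not_le)
    then obtain \<epsilon>' where \<epsilon>': "\<epsilon>' > 0" "\<forall>h\<in>\<Sigma> (r - 1). \<epsilon>' \<le> form_dist n (2 * d) g h"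
      using sums_of_squares_closed[of g n d "r - 1"] g(1) sub[of r] by (auto simp: \<Sigma>_def)
    \<comment> \<open>\<open>\<delta>\<close> keeps the ball inside \<Sigma>(r),
      \<open>\<epsilon>'\<close> keeps it off \<Sigma>(r-1).\<close>
    define T where "T = {h \<in> forms n (2 * d). form_dist n (2 * d) g h < min \<delta> \<epsilon>'}"
    have "T \<subseteq> \<Sigma> r - \<Sigma> (r - 1)"
    proof
      fix h assume "h \<in> T"
      then have "h \<in> forms n (2 * d)" "form_dist n (2 * d) g h < \<delta>" "form_dist n (2 * d) g h < \<epsilon>'"
        by (simp_all add: T_def)
      then show "h \<in> \<Sigma> r - \<Sigma> (r - 1)" using g(4) \<epsilon>'(2) by (meson DiffI not_le)
    qed
    moreover have "openin (forms_topology n (2 * d)) T"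
      unfolding T_def by (rule openin_forms_topology_ball)
    moreover have "g \<in> T" using g(1,3) \<epsilon>'(1) sub[of r] by (auto simp: T_def l1norm_def)
    ultimately have "g \<in> forms_topology n (2 * d) interior_of (\<Sigma> r - \<Sigma> (r - 1))"
      by (auto simp: interior_of_def)
    then show "r \<in> typical_sos_lengths n d"
      using \<open>1 \<le> r\<close> by (auto simp: typical_sos_lengths_def sos_cone_upto_eq \<Sigma>_def)
  qed
  have "1 \<le> p" using sums_of_squares_1_not_subset_0[OF assms(1), of d] p(2)
    by (cases p) (auto simp: \<Sigma>_def)
  \<comment> \<open>For t \<le> p only the existence of an interior point of \<Sigma>(t) matters; it
    is sought within distance 1 of the form 0. Its ball lies in \<Sigma>(p), so \<open>p\<close>
    squares are dense over the complex numbers.\<close>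
  have "0 \<in> \<Sigma> t" using mono[of 0 t] by (auto simp: \<Sigma>_def sums_of_squares_def)
  moreover have "zariski_dense_in_forms n (2 * d) (sums_of_squares n d t :: complex mpoly set)"
    by (simp add: zariski_dense_iff_generic_sos_length_le generic_sos_length_ge_1 t_def del: One_nat_def)
  ultimately
  obtain g \<delta> where g: "g \<in> \<Sigma> t" "\<delta> > 0"
      "\<And>h. h \<in> forms n (2 * d) \<Longrightarrow> form_dist n (2 * d) g h < \<delta> \<Longrightarrow> h \<in> \<Sigma> t"
    using sums_of_squares_interior_dense[of n d t 0 1] unfolding \<Sigma>_def by auto
  have "zariski_dense_in_forms n (2 * d) (sums_of_squares n d p :: complex mpoly set)"
    by (rule interior_sums_of_squares_imp_zariski_dense[OF _ g(2)])
      (use g(1,3) p(2) sub[of t] in \<open>auto simp: \<Sigma>_def\<close>)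
  then have "t \<le> p" unfolding t_def using zariski_dense_iff_generic_sos_length_le[OF \<open>1 \<le> p\<close>] by blast
  have "enat ` typical_sos_lengths n d = {enat t..enat p}"
  proof (intro equalityI subsetI)
    fix x assume "x \<in> {enat t..enat p}"
    then obtain k where "x = enat k" "t \<le> k" "k \<le> p" by (cases x) auto
    then show "x \<in> enat ` typical_sos_lengths n d" using typical_iff by blast
  qed (auto simp: typical_iff)
  then show ?thesis using \<open>t \<le> p\<close> p(1) by (simp add: t_def)
qed

end
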